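(* Let $\alpha\in(1,2)$ and let $X_\alpha$ be a rotationally invariant $\alpha$-stable random vector of $\mathbb{R}^d$ with law $\mu_\alpha$ and with characteristic function $\varphi(\xi)=\exp\left(-\|\xi\|^\alpha/2\right)$, $\xi\in\mathbb{R}^d$. Let $U_\alpha$ be the functional defined, for every probability measure $\mu$ on $\mathbb{R}^d$, by $$U_\alpha(\mu)=\sup_{f\in\mathcal{H}_\alpha}\frac{\operatorname{Var}(f(X))}{\mathbb{E}\int_{\mathbb{R}^d}|f(X+u)-f(X)|^2\nu_\alpha(du)},$$ where $X\sim\mu$ and $\mathcal{H}_\alpha$ is the set of functions $f:\mathbb{R}^d\to\mathbb{R}$ such that $\operatorname{Var}(f(X))<+\infty$ and $0<\mathbb{E}\int_{\mathbb{R}^d}|f(X+u)-f(X)|^2\nu_\alpha(du)<+\infty$. Then $$U_\alpha(\mu_\alpha)=1.$$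
   Context: $\|\cdot\|$: Euclidean norm on $\mathbb{R}^d$. $\nu_\alpha$ is the Lévy measure of $X_\alpha$: $\nu_\alpha(du)=\frac{c_{\alpha,d}}{\|u\|^{d+\alpha}}du$ with $c_{\alpha,d}=\frac{-\alpha(\alpha-1)\Gamma((\alpha+d)/2)}{4\cos(\alpha\pi/2)\Gamma((\alpha+1)/2)\pi^{(d-1)/2}\Gamma(2-\alpha)}$, $\Gamma$ being Euler's Gamma function. Functions are understood to be Borel measurable. *)

theory Defs
  imports "HOL-Probability.Probability"
begin

text \<open>
  \<open>\<real>\<^sup>d\<close> is rendered by a type of class \<^class>\<open>euclidean_space\<close>, with \<open>d = DIM('a)\<close>;
  its Borel probability measures are the measures \<open>\<mu>\<close> with
  \<open>prob_space \<mu>\<close> and \<open>sets \<mu> = sets borel\<close>.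
\<close>

definition stable_const :: "real \<Rightarrow> nat \<Rightarrow> real" where
  "stable_const \<alpha> d =
     (- \<alpha> * (\<alpha> - 1) * Gamma ((\<alpha> + real d) / 2)) /
     (4 * cos (\<alpha> * pi / 2) * Gamma ((\<alpha> + 1) / 2) * pi powr ((real d - 1) / 2) * Gamma (2 - \<alpha>))"

text \<open>
  For \<open>1 < \<alpha> < 2\<close> the constant is positive, so \<^const>\<open>ennreal\<close> does not truncate. At \<open>u = 0\<close>
  the density takes the conventional value \<open>0\<close>, which is irrelevant since \<open>{0}\<close> is a null set.
\<close>

definition stable_levy_measure :: "real \<Rightarrow> 'a::euclidean_space measure" where
  "stable_levy_measure \<alpha> =
     density lborel (\<lambda>u. ennreal (stable_const \<alpha> DIM('a) / norm u powr (real DIM('a) + \<alpha>)))"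

definition char_fun :: "'a::euclidean_space measure \<Rightarrow> 'a \<Rightarrow> complex" where
  "char_fun \<mu> \<xi> = (CLINT x|\<mu>. iexp (\<xi> \<bullet> x))"

definition rotationally_invariant :: "'a::euclidean_space measure \<Rightarrow> bool" where
  "rotationally_invariant \<mu> \<longleftrightarrow>
     (\<forall>T. orthogonal_transformation T \<longrightarrow> distr \<mu> borel T = \<mu>)"

text \<open>
  Stability of index \<open>\<alpha>\<close>: if \<open>Y\<close>, \<open>Z\<close> are independent with law \<open>\<mu>\<close> and \<open>a, b > 0\<close>, then
  \<open>a Y + b Z\<close> has the law of \<open>(a\<^sup>\<alpha> + b\<^sup>\<alpha>)\<^sup>1\<^sup>/\<^sup>\<alpha> Y + v\<close> for some deterministic vector \<open>v\<close>.
\<close>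

definition stable_law :: "real \<Rightarrow> 'a::euclidean_space measure \<Rightarrow> bool" where
  "stable_law \<alpha> \<mu> \<longleftrightarrow>
     (\<forall>a>0. \<forall>b>0. \<exists>v.
        distr (\<mu> \<Otimes>\<^sub>M \<mu>) borel (\<lambda>(y, z). a *\<^sub>R y + b *\<^sub>R z) =
        distr \<mu> borel (\<lambda>y. ((a powr \<alpha> + b powr \<alpha>) powr (1 / \<alpha>)) *\<^sub>R y + v))"

definition stable_energy ::
    "real \<Rightarrow> 'a::euclidean_space measure \<Rightarrow> ('a \<Rightarrow> real) \<Rightarrow> ennreal" where
  "stable_energy \<alpha> \<mu> f =
     (\<integral>\<^sup>+ x. (\<integral>\<^sup>+ u. ennreal (\<bar>f (x + u) - f x\<bar>\<^sup>2) \<partial>stable_levy_measure \<alpha>) \<partial>\<mu>)"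

text \<open>
  The Bochner integral of a non-integrable function is \<open>0\<close>, so finiteness of the variance
  is spelled out: both the mean and the variance have to be integrals of integrable functions.
\<close>

definition finite_variance :: "'a measure \<Rightarrow> ('a \<Rightarrow> real) \<Rightarrow> bool" where
  "finite_variance \<mu> f \<longleftrightarrow>
     integrable \<mu> f \<and> integrable \<mu> (\<lambda>x. (f x - prob_space.expectation \<mu> f)\<^sup>2)"

definition H_stable :: "real \<Rightarrow> 'a::euclidean_space measure \<Rightarrow> ('a \<Rightarrow> real) set" where
  "H_stable \<alpha> \<mu> =
     {f \<in> borel_measurable borel.
        finite_variance \<mu> f \<and> 0 < stable_energy \<alpha> \<mu> f \<and> stable_energy \<alpha> \<mu> f < \<infinity>}"

text \<open>
  The supremum is taken in \<open>[0, \<infinity>]\<close>; on \<open>H_stable\<close> the quotient is one of finite numbers with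
  positive denominator.
\<close>

definition U_stable :: "real \<Rightarrow> 'a::euclidean_space measure \<Rightarrow> ennreal" where
  "U_stable \<alpha> \<mu> =
     (SUP f\<in>H_stable \<alpha> \<mu>. ennreal (prob_space.variance \<mu> f) / stable_energy \<alpha> \<mu> f)"

end

theory Submission
  imports Defs
begin

text \<open>
  Let \<open>\<psi>\<close> be the Levy exponent, \<open>\<phi> = exp (- \<psi>)\<close> and \<open>B j k = \<psi> j + \<psi> k - \<psi> (j - k)\<close>. On
  trigonometric polynomials the variance has kernel \<open>\<phi> (j - k) - \<phi> j \<phi> k = \<phi> j \<phi> k (exp B - 1)\<close> and
  the jump energy has kernel \<open>\<phi> (j - k) B = \<phi> j \<phi> k B exp B\<close>. Multiplication by \<open>B\<close> preserves positive
  definiteness, and \<open>x exp x - exp x + 1\<close> has nonnegative Taylor coefficients, so the energy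
  dominates the variance. To reach all Borel functions of finite energy, only the jumps seen by a
  bounded truncation of the Levy density are charged to the energy: the truncated energy is
  continuous in \<open>L\<^sup>2\<close> of a finite measure, where trigonometric polynomials are dense, and the
  remaining part of the variance form is bounded by the \<open>L\<^sup>2\<close> norm and tends to \<open>0\<close> on each
  trigonometric polynomial. Equality is approached by \<open>cos (\<xi> \<bullet> x)\<close> or \<open>sin (\<xi> \<bullet> x)\<close> as \<open>\<xi>\<close> tends to
  \<open>0\<close>, because their variances sum to \<open>1 - exp (- 2 \<psi> \<xi>)\<close> and their energies to \<open>2 \<psi> \<xi>\<close>. That
  \<open>\<psi> \<xi> = \<parallel>\<xi>\<parallel>\<^sup>\<alpha> / 2\<close> follows by writing the Levy density as a mixture of Gaussians.
\<close>

section \<open>Density of trigonometric polynomials\<close>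

text \<open>The obstacle is that energy is not continuous in L2: the jump density may have infinite
  mass near the origin, so a trigonometric polynomial close to \<open>f\<close> in L2 can have an
  energy unrelated to that of \<open>f\<close>. Truncation restores continuity, but it forces two
  different approximants. The remainder form is known to become small only on a polynomial fixed
  before the truncation level, whereas the polynomial that imitates the energy of \<open>f\<close>
  can be chosen only after that level. The bound of the remainder form by the L2 form carries the
  smallness from the first polynomial to the second. The kernel \<open>B\<close> is a Gram kernel:
  it is the real part of the integral of \<open>(exp (i j.u) - 1) * cnj (exp (i k.u) - 1)\<close>
  against the density. This is why multiplication by it is a mixture of congruences and preserves
  positive definiteness.\<close>

definition trig_sum :: "'a::real_inner set \<Rightarrow> ('a \<Rightarrow> complex) \<Rightarrow> 'a \<Rightarrow> complex" where
  "trig_sum J c x = (\<Sum>j\<in>J. c j * iexp (j \<bullet> x))"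

definition trig_poly :: "('a::real_inner \<Rightarrow> complex) \<Rightarrow> bool" where
  "trig_poly T \<longleftrightarrow> (\<exists>J c. finite J \<and> T = trig_sum J c)"

text \<open>Padding with zero coefficients puts two trigonometric polynomials on one common
  frequency set, which both adding them and comparing their quadratic forms require.\<close>

lemma trig_sum_extend:
  assumes "finite J'" "J \<subseteq> J'"
  shows "trig_sum J c = trig_sum J' (\<lambda>j. if j \<in> J then c j else 0)"
proof
  fix x
  show "trig_sum J c x = trig_sum J' (\<lambda>j. if j \<in> J then c j else 0) x"
    unfolding trig_sum_def using assms by (intro sum.mono_neutral_cong_left) auto
qed

lemma trig_poly_add:
  assumes "trig_poly S" "trig_poly T"
  shows "trig_poly (\<lambda>x. S x + T x)"
proof -
  obtain J c K d where *: "finite J" "S = trig_sum J c" "finite K" "T = trig_sum K d"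
    using assms by (auto simp: trig_poly_def)
  have "(\<lambda>x. S x + T x)
      = trig_sum (J \<union> K) (\<lambda>j. (if j \<in> J then c j else 0) + (if j \<in> K then d j else 0))"
    unfolding * trig_sum_extend[of "J \<union> K" J, OF finite_UnI[OF *(1,3)] Un_upper1]
      trig_sum_extend[of "J \<union> K" K, OF finite_UnI[OF *(1,3)] Un_upper2]
    by (simp add: trig_sum_def sum.distrib distrib_right fun_eq_iff)
  with * show ?thesis
    unfolding trig_poly_def by blast
qed

text \<open>Multiplication by a character translates the frequency set by \<open>k\<close>;
  translation is injective, so no coefficients merge.\<close>

lemma trig_poly_iexp_mult:
  assumes "trig_poly T"
  shows "trig_poly (\<lambda>x. a * iexp (k \<bullet> x) * T x)"
proof -
  obtain J c where *: "finite J" "T = trig_sum J c"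
    using assms by (auto simp: trig_poly_def)
  have "(\<lambda>x. a * iexp (k \<bullet> x) * T x) = trig_sum ((+) k ` J) (\<lambda>j. a * c (j - k))"
    by (auto simp: * trig_sum_def sum.reindex sum_distrib_left inner_add_left distrib_left exp_add
        mult_ac fun_eq_iff)
  with * show ?thesis
    unfolding trig_poly_def by blast
qed

lemma trig_poly_iexp: "trig_poly (\<lambda>x. a * iexp (k \<bullet> x))"
  unfolding trig_poly_def
  by (intro exI[of _ "{k}"] exI[of _ "\<lambda>_. a"]) (simp add: trig_sum_def fun_eq_iff)

lemma trig_poly_const: "trig_poly (\<lambda>x. a)"
  using trig_poly_iexp[of a 0] by simp

lemma trig_poly_sum:
  assumes "finite I" "\<And>i. i \<in> I \<Longrightarrow> trig_poly (T i)"
  shows "trig_poly (\<lambda>x. \<Sum>i\<in>I. T i x)"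
  using assms by (induction I rule: finite_induct) (auto intro: trig_poly_add trig_poly_const)

lemma trig_poly_mult:
  assumes "trig_poly S" "trig_poly T"
  shows "trig_poly (\<lambda>x. S x * T x)"
proof -
  obtain J c where *: "finite J" "S = trig_sum J c"
    using assms by (auto simp: trig_poly_def)
  have "(\<lambda>x. S x * T x) = (\<lambda>x. \<Sum>j\<in>J. c j * iexp (j \<bullet> x) * T x)"
    by (simp add: * trig_sum_def sum_distrib_right)
  then show ?thesis
    by (simp add: trig_poly_sum trig_poly_iexp_mult assms *)
qed

lemma trig_poly_cmult: "trig_poly T \<Longrightarrow> trig_poly (\<lambda>x. a * T x)"
  by (rule trig_poly_mult[OF trig_poly_const])

lemma trig_poly_sin: "trig_poly (\<lambda>x. of_real (sin (k \<bullet> x)))"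
proof -
  have "(\<lambda>x. complex_of_real (sin (k \<bullet> x)))
      = (\<lambda>x. (1 / (2 * \<i>)) * iexp (k \<bullet> x) + (- 1 / (2 * \<i>)) * iexp ((- k) \<bullet> x))"
    by (simp add: fun_eq_iff sin_of_real[symmetric] sin_exp_eq field_simps)
  then show ?thesis
    by (simp only: trig_poly_add trig_poly_iexp)
qed

lemma measurable_trig_poly: "trig_poly T \<Longrightarrow> T \<in> borel_measurable borel"
  for T :: "'a::euclidean_space \<Rightarrow> complex"
  by (auto simp: trig_poly_def trig_sum_def[abs_def])

text \<open>As \<open>r\<close> grows, \<open>r * sin (t / r)\<close> tends to \<open>t\<close>,
  while for fixed \<open>r > 0\<close> it is bounded and periodic in \<open>t\<close>. Each
  coordinate is thus a bounded trigonometric polynomial that imitates the coordinate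
  function.\<close>

definition sine_map :: "real \<Rightarrow> 'a::euclidean_space \<Rightarrow> 'a" where
  "sine_map r x = (\<Sum>i\<in>Basis. (r * sin ((x \<bullet> i) / r)) *\<^sub>R i)"

lemma trig_poly_sine_map:
  assumes "real_polynomial_function p"
  shows "trig_poly (\<lambda>x. of_real (p (sine_map r x)))"
  using assms
proof induction
  case (linear p)
  then have "(\<lambda>x. complex_of_real (p (sine_map r x)))
      = (\<lambda>x. \<Sum>i\<in>Basis. of_real (r * p i) * of_real (sin ((i /\<^sub>R r) \<bullet> x)))"
    by (auto simp: sine_map_def linear_sum linear_scale bounded_linear.linear fun_eq_iff
        inner_commute divide_inverse mult_ac)
  then show ?case
    by (simp only: trig_poly_sum finite_Basis trig_poly_cmult trig_poly_sin)
qed (simp_all add: trig_poly_add trig_poly_mult trig_poly_const)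

text \<open>\<open>r * sin (t / r)\<close> is the difference quotient of \<open>sin (t * h)\<close>
  at \<open>0\<close> for the increment \<open>h = 1 / r\<close>.\<close>

lemma sine_map_tendsto: "(\<lambda>n. sine_map (real (Suc n)) x) \<longlonglongrightarrow> x"
proof -
  have "(\<lambda>n. real (Suc n) * sin (t / real (Suc n))) \<longlonglongrightarrow> t" for t :: real
  proof -
    have "((\<lambda>h. sin (t * h)) has_real_derivative t) (at 0)"
      by (auto intro!: derivative_eq_intros)
    then have "((\<lambda>h. sin (t * h) / h) \<longlongrightarrow> t) (at 0)"
      by (simp add: DERIV_def)
    moreover have "filterlim (\<lambda>n. inverse (real (Suc n))) (at 0) sequentially"
      using LIMSEQ_inverse_real_of_nat by (auto simp: filterlim_at)
    ultimately show ?thesis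
      using filterlim_compose by (fastforce simp: divide_inverse mult.commute)
  qed
  then have "(\<lambda>n. sine_map (real (Suc n)) x) \<longlonglongrightarrow> (\<Sum>i\<in>Basis. (x \<bullet> i) *\<^sub>R i)"
    unfolding sine_map_def by (intro tendsto_intros)
  then show ?thesis
    by (simp add: euclidean_representation)
qed

lemma sine_map_in_cbox:
  assumes "0 \<le> r"
  shows "sine_map r x \<in> cbox (\<Sum>i\<in>Basis. (- r) *\<^sub>R i :: 'a::euclidean_space) (\<Sum>i\<in>Basis. r *\<^sub>R i)"
proof -
  have "\<bar>r * sin t\<bar> \<le> r" for t
    using assms abs_sin_le_one[of t] by (simp add: abs_mult mult_left_le)
  then have "- r \<le> r * sin t \<and> r * sin t \<le> r" for t
    by (simp add: abs_le_iff minus_le_iff)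
  then show ?thesis
    by (simp add: mem_box sine_map_def del: scaleR_minus_left)
qed

text \<open>
  Composing with the almost periodic map \<^const>\<open>sine_map\<close> turns uniform polynomial approximation
  on a cube into globally bounded approximation by trigonometric polynomials.
\<close>

lemma bounded_continuous_trig_approx:
  fixes g :: "'a::euclidean_space \<Rightarrow> real"
  assumes g: "continuous_on UNIV g" and bound: "\<And>x. \<bar>g x\<bar> \<le> C"
  obtains T :: "nat \<Rightarrow> 'a \<Rightarrow> complex"
  where "\<And>n. trig_poly (T n)" "\<And>n x. norm (T n x) \<le> C + 1"
    "\<And>x. (\<lambda>n. T n x) \<longlonglongrightarrow> of_real (g x)"
proof -
  define Q where "Q n = cbox (\<Sum>i\<in>Basis. (- real (Suc n)) *\<^sub>R i) (\<Sum>i\<in>Basis. real (Suc n) *\<^sub>R i :: 'a)" for n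
  have "\<exists>p. real_polynomial_function p \<and> (\<forall>x\<in>Q n. \<bar>g x - p x\<bar> < 1 / real (Suc n))" for n
    by (rule Stone_Weierstrass_real_polynomial_function[of "Q n" g "1 / real (Suc n)"])
      (auto simp: Q_def intro: continuous_on_subset[OF g])
  then obtain p where p: "\<And>n. real_polynomial_function (p n)"
    and close: "\<And>n x. x \<in> Q n \<Longrightarrow> \<bar>g x - p n x\<bar> < 1 / real (Suc n)"
    by metis
  let ?S = "\<lambda>n. sine_map (real (Suc n))"
  let ?T = "\<lambda>n x. complex_of_real (p n (?S n x))"
  have S: "\<bar>g (?S n x) - p n (?S n x)\<bar> < 1 / real (Suc n)" for n x
    by (rule close) (use sine_map_in_cbox[of "real (Suc n)" x] in \<open>simp add: Q_def\<close>)
  show thesis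
  proof
    show "trig_poly (?T n)" for n
      by (intro trig_poly_sine_map p)
    show "norm (?T n x) \<le> C + 1" for n x
    proof -
      have "1 / real (Suc n) \<le> 1" by simp
      then show ?thesis
        using S[of n x] bound[of "?S n x"] unfolding norm_of_real by linarith
    qed
    show "(\<lambda>n. ?T n x) \<longlonglongrightarrow> of_real (g x)" for x
    proof (intro tendsto_of_real)
      have "(\<lambda>n. g (?S n x)) \<longlonglongrightarrow> g x"
        using g sine_map_tendsto by (intro continuous_on_tendsto_compose[OF g]) auto
      moreover have "(\<lambda>n. g (?S n x) - p n (?S n x)) \<longlonglongrightarrow> 0"
      proof (rule Lim_null_comparison)
        show "\<forall>\<^sub>F n in sequentially. norm (g (?S n x) - p n (?S n x)) \<le> 1 / real (Suc n)"
          unfolding real_norm_def by (intro always_eventually allI less_imp_le S)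
        show "(\<lambda>n. 1 / real (Suc n)) \<longlonglongrightarrow> 0"
          using LIMSEQ_inverse_real_of_nat by (simp add: divide_inverse)
      qed
      ultimately have "(\<lambda>n. g (?S n x) - (g (?S n x) - p n (?S n x))) \<longlonglongrightarrow> g x - 0"
        by (rule tendsto_diff)
      then show "(\<lambda>n. p n (?S n x)) \<longlonglongrightarrow> g x" by simp
    qed
  qed
qed

text \<open>Young's inequality \<open>2 * p * q \<le> \<eta> * p^2 + q^2 / \<eta>\<close>. The free
  weight keeps one coefficient arbitrarily close to \<open>1\<close>, so that approximation does not
  spoil the constant in the Poincare inequality.\<close>

lemma norm_diff_square_le_weighted:
  fixes a b c :: "'b::real_normed_vector"
  assumes \<eta>: "0 < \<eta>"
  shows "(norm (a - b))\<^sup>2 \<le> (1 + \<eta>) * (norm (a - c))\<^sup>2 + (1 + 1 / \<eta>) * (norm (c - b))\<^sup>2"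
proof -
  have "(norm (a - b))\<^sup>2 \<le> (norm (a - c) + norm (c - b))\<^sup>2"
    using norm_triangle_ineq[of "a - c" "c - b"] by (intro power_mono) simp_all
  also have "\<dots> \<le> (1 + \<eta>) * (norm (a - c))\<^sup>2 + (1 + 1 / \<eta>) * (norm (c - b))\<^sup>2"
  proof -
    have "0 \<le> (\<eta> * norm (a - c) - norm (c - b))\<^sup>2 / \<eta>"
      using \<eta> by simp
    also have "\<dots> = \<eta> * (norm (a - c))\<^sup>2 + (norm (c - b))\<^sup>2 / \<eta> - 2 * norm (a - c) * norm (c - b)"
      using \<eta> by (simp add: power2_eq_square field_simps)
    finally show ?thesis
      by (simp add: power2_sum algebra_simps)
  qed
  finally show ?thesis .
qed

lemma norm_diff_square_le:
  fixes a b c :: "'b::real_normed_vector"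
  shows "(norm (a - b))\<^sup>2 \<le> 2 * (norm (a - c))\<^sup>2 + 2 * (norm (c - b))\<^sup>2"
  using norm_diff_square_le_weighted[of 1 a b c] by simp

section \<open>The L2 closure of the trigonometric polynomials\<close>

definition trig_approximable :: "'a::euclidean_space measure \<Rightarrow> ('a \<Rightarrow> complex) \<Rightarrow> bool" where
  "trig_approximable M h \<longleftrightarrow> h \<in> borel_measurable borel \<and>
     (\<forall>e>0. \<exists>T. trig_poly T \<and> (\<integral>\<^sup>+x. ennreal ((norm (h x - T x))\<^sup>2) \<partial>M) < ennreal e)"

lemma trig_approximable_trig_poly: "trig_poly T \<Longrightarrow> trig_approximable M T"
  by (auto simp: trig_approximable_def measurable_trig_poly intro!: exI[of _ T])

lemma trig_approximable_L2_limit: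
  assumes M: "sets M = sets borel" and h: "h \<in> borel_measurable borel"
    and F: "\<And>n. trig_approximable M (F n)"
    and lim: "(\<lambda>n. \<integral>\<^sup>+x. ennreal ((norm (h x - F n x))\<^sup>2) \<partial>M) \<longlonglongrightarrow> 0"
  shows "trig_approximable M h"
  unfolding trig_approximable_def
proof (intro conjI h allI impI)
  note [measurable_cong] = M
  note h[measurable]
  fix e :: real
  assume e: "0 < e"
  \<comment> \<open>A quarter of \<open>e\<close>, because the crude triangle inequality doubles
    each of the two errors.\<close>
  obtain n where n: "(\<integral>\<^sup>+x. ennreal ((norm (h x - F n x))\<^sup>2) \<partial>M) < ennreal (e / 4)"
    using order_tendstoD(2)[OF lim, of "ennreal (e / 4)"] e by (auto dest: eventually_happens)
  have [measurable]: "F n \<in> borel_measurable borel"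
    using F by (simp add: trig_approximable_def)
  obtain T where T: "trig_poly T"
    "(\<integral>\<^sup>+x. ennreal ((norm (F n x - T x))\<^sup>2) \<partial>M) < ennreal (e / 4)"
    using F[of n] e unfolding trig_approximable_def by (meson divide_pos_pos zero_less_numeral)
  note [measurable] = measurable_trig_poly[OF T(1)]
  have "(\<integral>\<^sup>+x. ennreal ((norm (h x - T x))\<^sup>2) \<partial>M)
      \<le> (\<integral>\<^sup>+x. 2 * ennreal ((norm (h x - F n x))\<^sup>2) + 2 * ennreal ((norm (F n x - T x))\<^sup>2) \<partial>M)"
    using norm_diff_square_le[of "h _" "T _" "F n _"]
    by (intro nn_integral_mono) (simp add: ennreal_plus[symmetric] ennreal_mult'[symmetric] del: ennreal_plus flip: ennreal_numeral)
  also have "\<dots> = 2 * (\<integral>\<^sup>+x. ennreal ((norm (h x - F n x))\<^sup>2) \<partial>M)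
      + 2 * (\<integral>\<^sup>+x. ennreal ((norm (F n x - T x))\<^sup>2) \<partial>M)"
    by (simp add: nn_integral_add nn_integral_cmult)
  also have "\<dots> < 2 * ennreal (e / 4) + 2 * ennreal (e / 4)"
    using n T(2) by (intro add_strict_mono ennreal_mult_strict_left_mono) auto
  also have "\<dots> = ennreal e"
    using e by (simp add: ennreal_plus[symmetric] ennreal_mult'[symmetric] del: ennreal_plus flip: ennreal_numeral)
  finally show "\<exists>T. trig_poly T \<and> (\<integral>\<^sup>+x. ennreal ((norm (h x - T x))\<^sup>2) \<partial>M) < ennreal e"
    using T(1) by blast
qed

text \<open>The bound by \<open>w\<close> passes to the limit \<open>h\<close>, so
  \<open>4 * w^2\<close> dominates the squared errors and pointwise convergence becomes convergence
  in L2.\<close>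

lemma trig_approximable_dominated:
  assumes M: "sets M = sets borel" and F: "\<And>n. trig_approximable M (F n)"
    and lim: "\<And>x. (\<lambda>n. F n x) \<longlonglongrightarrow> h x"
    and bound: "\<And>n x. norm (F n x) \<le> w x"
    and w: "w \<in> borel_measurable borel" "(\<integral>\<^sup>+x. ennreal ((w x)\<^sup>2) \<partial>M) < \<infinity>"
  shows "trig_approximable M h"
proof (rule trig_approximable_L2_limit[OF M _ F])
  note [measurable_cong] = M
  note w(1)[measurable]
  have F_meas[measurable]: "\<And>n. F n \<in> borel_measurable borel"
    using F by (simp add: trig_approximable_def)
  show h[measurable]: "h \<in> borel_measurable borel"
    by (rule borel_measurable_LIMSEQ_metric[OF F_meas lim])
  have "norm (h x) \<le> w x" for x
    by (rule LIMSEQ_le_const2[OF tendsto_norm[OF lim]]) (use bound in blast)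
  then have "norm (h x - F n x) \<le> 2 * w x" for n x
    using bound[of n x] norm_triangle_ineq4[of "h x" "F n x"] by (smt (verit, best))
  then have le: "(norm (h x - F n x))\<^sup>2 \<le> 4 * (w x)\<^sup>2" for n x
    using power_mono[of "norm (h x - F n x)" "2 * w x" 2] by (simp add: power_mult_distrib)
  have "(\<lambda>n. \<integral>\<^sup>+x. ennreal ((norm (h x - F n x))\<^sup>2) \<partial>M) \<longlonglongrightarrow> (\<integral>\<^sup>+x. 0 \<partial>M)"
  proof (rule nn_integral_dominated_convergence[where w = "\<lambda>x. 4 * ennreal ((w x)\<^sup>2)"])
    show "AE x in M. ennreal ((norm (h x - F n x))\<^sup>2) \<le> 4 * ennreal ((w x)\<^sup>2)" for n
      using le[of _ n] by (simp add: ennreal_mult'[symmetric] flip: ennreal_numeral)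
    show "(\<integral>\<^sup>+x. 4 * ennreal ((w x)\<^sup>2) \<partial>M) < \<infinity>"
      using w(2) by (simp add: nn_integral_cmult ennreal_mult_less_top)
    have "(\<lambda>n. ennreal ((norm (h x - F n x))\<^sup>2)) \<longlonglongrightarrow> ennreal ((norm (h x - h x))\<^sup>2)" for x
      by (intro tendsto_intros tendsto_ennrealI lim)
    then show "AE x in M. (\<lambda>n. ennreal ((norm (h x - F n x))\<^sup>2)) \<longlonglongrightarrow> 0"
      by simp
  qed auto
  then show "(\<lambda>n. \<integral>\<^sup>+x. ennreal ((norm (h x - F n x))\<^sup>2) \<partial>M) \<longlonglongrightarrow> 0"
    by simp
qed

context
  fixes M :: "'a::euclidean_space measure"
  assumes M: "sets M = sets borel" and fin: "finite_measure M"
begin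

lemma trig_approximable_bounded:
  assumes "\<And>n. trig_approximable M (F n)" "\<And>x. (\<lambda>n. F n x) \<longlonglongrightarrow> h x"
    and "\<And>n x. norm (F n x) \<le> C"
  shows "trig_approximable M h"
proof -
  interpret finite_measure M by (rule fin)
  show ?thesis
    by (rule trig_approximable_dominated[OF M assms(1,2), of "\<lambda>_. C"])
      (auto simp: assms(3) ennreal_mult_eq_top_iff emeasure_finite less_top[symmetric])
qed

lemma trig_approximable_add:
  assumes f: "trig_approximable M f" and g: "trig_approximable M g"
  shows "trig_approximable M (\<lambda>x. f x + g x)"
  unfolding trig_approximable_def
proof (intro conjI allI impI)
  note [measurable_cong] = M
  have [measurable]: "f \<in> borel_measurable borel" "g \<in> borel_measurable borel"
    using f g by (auto simp: trig_approximable_def)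
  show "(\<lambda>x. f x + g x) \<in> borel_measurable borel" by measurable
  fix e :: real
  assume e: "0 < e"
  obtain S where S: "trig_poly S"
    "(\<integral>\<^sup>+x. ennreal ((norm (f x - S x))\<^sup>2) \<partial>M) < ennreal (e / 4)"
    using f e unfolding trig_approximable_def by (meson divide_pos_pos zero_less_numeral)
  obtain T where T: "trig_poly T"
    "(\<integral>\<^sup>+x. ennreal ((norm (g x - T x))\<^sup>2) \<partial>M) < ennreal (e / 4)"
    using g e unfolding trig_approximable_def by (meson divide_pos_pos zero_less_numeral)
  note [measurable] = measurable_trig_poly[OF S(1)] measurable_trig_poly[OF T(1)]
  have le: "(norm (f x + g x - (S x + T x)))\<^sup>2
      \<le> 2 * (norm (f x - S x))\<^sup>2 + 2 * (norm (g x - T x))\<^sup>2" for x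
    using norm_diff_square_le[of "f x + g x" "S x + T x" "S x + g x"] by (simp add: algebra_simps)
  have "(\<integral>\<^sup>+x. ennreal ((norm (f x + g x - (S x + T x)))\<^sup>2) \<partial>M)
      \<le> (\<integral>\<^sup>+x. 2 * ennreal ((norm (f x - S x))\<^sup>2) + 2 * ennreal ((norm (g x - T x))\<^sup>2) \<partial>M)"
    using le by (intro nn_integral_mono) (simp add: ennreal_plus[symmetric] ennreal_mult'[symmetric] del: ennreal_plus flip: ennreal_numeral)
  also have "\<dots> = 2 * (\<integral>\<^sup>+x. ennreal ((norm (f x - S x))\<^sup>2) \<partial>M)
      + 2 * (\<integral>\<^sup>+x. ennreal ((norm (g x - T x))\<^sup>2) \<partial>M)"
    by (simp add: nn_integral_add nn_integral_cmult)
  also have "\<dots> < 2 * ennreal (e / 4) + 2 * ennreal (e / 4)"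
    using S(2) T(2) by (intro add_strict_mono ennreal_mult_strict_left_mono) auto
  also have "\<dots> = ennreal e"
    using e by (simp add: ennreal_plus[symmetric] ennreal_mult'[symmetric] del: ennreal_plus flip: ennreal_numeral)
  finally show "\<exists>T. trig_poly T \<and> (\<integral>\<^sup>+x. ennreal ((norm (f x + g x - T x))\<^sup>2) \<partial>M) < ennreal e"
    using trig_poly_add[OF S(1) T(1)] by blast
qed

lemma trig_approximable_cmult:
  assumes f: "trig_approximable M f"
  shows "trig_approximable M (\<lambda>x. a * f x)"
  unfolding trig_approximable_def
proof (intro conjI allI impI)
  note [measurable_cong] = M
  have [measurable]: "f \<in> borel_measurable borel"
    using f by (auto simp: trig_approximable_def)
  show "(\<lambda>x. a * f x) \<in> borel_measurable borel" by measurable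
  fix e :: real
  assume e: "0 < e"
  define b where "b = (norm a)\<^sup>2 + 1"
  have b: "0 < b" "(norm a)\<^sup>2 \<le> b" by (auto simp: b_def add_nonneg_pos)
  obtain T where T: "trig_poly T"
    "(\<integral>\<^sup>+x. ennreal ((norm (f x - T x))\<^sup>2) \<partial>M) < ennreal (e / b)"
    using f e b unfolding trig_approximable_def by (meson divide_pos_pos)
  note [measurable] = measurable_trig_poly[OF T(1)]
  have "(norm (a * f x - a * T x))\<^sup>2 \<le> b * (norm (f x - T x))\<^sup>2" for x
    unfolding right_diff_distrib[symmetric] norm_mult power_mult_distrib
    using b by (intro mult_right_mono) auto
  then have "(\<integral>\<^sup>+x. ennreal ((norm (a * f x - a * T x))\<^sup>2) \<partial>M)
      \<le> (\<integral>\<^sup>+x. ennreal b * ennreal ((norm (f x - T x))\<^sup>2) \<partial>M)"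
    using b by (intro nn_integral_mono) (simp flip: ennreal_mult')
  also have "\<dots> = ennreal b * (\<integral>\<^sup>+x. ennreal ((norm (f x - T x))\<^sup>2) \<partial>M)"
    by (simp add: nn_integral_cmult)
  also have "\<dots> < ennreal b * ennreal (e / b)"
    using T(2) b by (intro ennreal_mult_strict_left_mono) auto
  also have "\<dots> = ennreal e"
    using e b by (simp add: ennreal_mult'[symmetric])
  finally show "\<exists>T. trig_poly T \<and> (\<integral>\<^sup>+x. ennreal ((norm (a * f x - T x))\<^sup>2) \<partial>M) < ennreal e"
    using trig_poly_cmult[OF T(1), of a] by blast
qed

lemma trig_approximable_sum:
  assumes "finite I" "\<And>i. i \<in> I \<Longrightarrow> trig_approximable M (f i)"
  shows "trig_approximable M (\<lambda>x. \<Sum>i\<in>I. f i x)"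
  using assms
proof (induction I rule: finite_induct)
  case empty
  show ?case
    by (simp add: trig_approximable_trig_poly trig_poly_const)
next
  case (insert i I)
  then show ?case
    by (simp add: trig_approximable_add)
qed

lemma trig_approximable_continuous:
  fixes g :: "'a \<Rightarrow> real"
  assumes "continuous_on UNIV g" "\<And>x. \<bar>g x\<bar> \<le> C"
  shows "trig_approximable M (\<lambda>x. of_real (g x))"
proof (rule bounded_continuous_trig_approx[OF assms])
  fix T :: "nat \<Rightarrow> 'a \<Rightarrow> complex"
  assume T: "\<And>n. trig_poly (T n)" "\<And>n x. norm (T n x) \<le> C + 1"
    "\<And>x. (\<lambda>n. T n x) \<longlonglongrightarrow> of_real (g x)"
  show ?thesis
    by (rule trig_approximable_bounded[OF trig_approximable_trig_poly[OF T(1)] T(3,2)])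
qed

text \<open>The functions \<open>max 0 (1 - n * infdist x A)\<close> are continuous, bounded by
  \<open>1\<close> and decrease to the indicator of a closed \<open>A\<close>. The empty set is set
  apart because \<open>infdist x {}\<close> is \<open>0\<close> by convention, which would turn all
  of them into \<open>1\<close>.\<close>

lemma trig_approximable_closed:
  assumes "closed A"
  shows "trig_approximable M (indicator A)"
proof (cases "A = {}")
  case True
  then have "(indicator A :: 'a \<Rightarrow> complex) = (\<lambda>x. 0)" by auto
  then show ?thesis
    by (simp only: trig_approximable_trig_poly trig_poly_const)
next
  case False
  define g where "g n x = max 0 (1 - real n * infdist x A)" for n x
  have g_bound: "\<bar>g n x\<bar> \<le> 1" for n x
    by (auto simp: g_def infdist_nonneg)
  show ?thesis
  proof (rule trig_approximable_bounded)
    show "trig_approximable M (\<lambda>x. of_real (g n x))" for n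
      by (rule trig_approximable_continuous[OF _ g_bound])
        (auto simp: g_def intro!: continuous_intros)
    show "norm (of_real (g n x) :: complex) \<le> 1" for n x
      using g_bound by simp
    show "(\<lambda>n. of_real (g n x) :: complex) \<longlonglongrightarrow> indicator A x" for x
    proof (cases "x \<in> A")
      case True
      then have "g n x = 1" for n
        by (simp add: g_def)
      with True show ?thesis by simp
    next
      assume "x \<notin> A"
      then have pos: "0 < infdist x A"
        using assms False in_closed_iff_infdist_zero infdist_nonneg[of x A] by fastforce
      obtain N where N: "1 < real N * infdist x A"
        using reals_Archimedean3[OF pos] by blast
      have "g n x = 0" if "N \<le> n" for n
      proof -
        have "real N * infdist x A \<le> real n * infdist x A"
          using that pos by (intro mult_right_mono) auto
        with N show ?thesis by (simp add: g_def)
      qed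
      then have "\<forall>\<^sub>F n in sequentially. (of_real (g n x) :: complex) = indicator A x"
        using \<open>x \<notin> A\<close> by (auto simp: eventually_sequentially)
      then show ?thesis
        by (rule tendsto_eventually)
    qed
  qed
qed

text \<open>Dynkin's argument: closed sets form an intersection-stable generator, complements
  correspond to \<open>1 - indicator\<close>, and disjoint unions are bounded pointwise limits of
  finite partial unions.\<close>

lemma trig_approximable_indicator:
  assumes "A \<in> sets borel"
  shows "trig_approximable M (indicator A)"
proof -
  have "A \<in> sigma_sets UNIV (Collect closed)"
    using assms by (simp add: borel_eq_closed)
  then show ?thesis
  proof (rule sigma_sets_induct_disjoint[rotated 2])
    show "Int_stable (Collect closed :: 'a set set)"
      by (auto simp: Int_stable_def)
    show "trig_approximable M (indicator A)" if "A \<in> Collect closed" for A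
      using that by (simp add: trig_approximable_closed)
    show "trig_approximable M (indicator {})"
      by (rule trig_approximable_closed) simp
    show "trig_approximable M (indicator (UNIV - A))" if "trig_approximable M (indicator A)" for A
    proof -
      have "trig_approximable M (\<lambda>x. 1 + (- 1) * indicator A x)"
        by (intro trig_approximable_add trig_approximable_cmult that trig_approximable_trig_poly trig_poly_const)
      then show ?thesis
        by (rule back_subst[of "trig_approximable M"]) (auto simp: fun_eq_iff split: split_indicator)
    qed
    fix A :: "nat \<Rightarrow> 'a set"
    assume disj: "disjoint_family A" and A: "\<And>n. trig_approximable M (indicator (A n))"
    have ind: "indicator (\<Union>i<n. A i) x = (\<Sum>i<n. indicator (A i) x :: complex)" for n x
      using disj by (subst indicator_UN_disjoint) (auto simp: disjoint_family_on_def)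
    show "trig_approximable M (indicator (\<Union>i. A i))"
    proof (rule trig_approximable_bounded[where F = "\<lambda>n. indicator (\<Union>i<n. A i)" and C = 1])
      show "trig_approximable M (indicator (\<Union>i<n. A i))" for n
        unfolding ind[abs_def] by (intro trig_approximable_sum A) simp
      show "(\<lambda>n. indicator (\<Union>i<n. A i) x) \<longlonglongrightarrow> (indicator (\<Union>i. A i) x :: complex)" for x
        by (rule LIMSEQ_indicator_UN)
    qed (auto split: split_indicator)
  qed simp
qed

text \<open>Simple functions can be chosen to converge pointwise with
  \<open>\<bar>F i x\<bar> \<le> 2 * \<bar>f x\<bar>\<close>, so the square integrability of
  \<open>f\<close> supplies the dominating function even if \<open>f\<close> is unbounded.\<close>

theorem trig_poly_dense_L2:
  fixes f :: "'a \<Rightarrow> real"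
  assumes f: "f \<in> borel_measurable borel" and L2: "(\<integral>\<^sup>+x. ennreal ((f x)\<^sup>2) \<partial>M) < \<infinity>"
  shows "trig_approximable M (\<lambda>x. of_real (f x))"
proof -
  obtain F where F: "\<And>i. simple_function borel (F i)" "\<And>x. (\<lambda>i. F i x) \<longlonglongrightarrow> f x"
    and bound: "\<And>i x. \<bar>F i x\<bar> \<le> 2 * \<bar>f x\<bar>"
    using borel_measurable_implies_sequence_metric[OF f, of 0] by auto
  show ?thesis
  proof (rule trig_approximable_dominated[OF M])
    show "trig_approximable M (\<lambda>x. of_real (F i x))" for i
    proof -
      have fin: "finite (range (F i))" and meas: "F i -` {y} \<in> sets borel" for y
        using simple_functionD[OF F(1)[of i]] by auto
      have "(\<lambda>x. complex_of_real (F i x))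
          = (\<lambda>x. \<Sum>y\<in>range (F i). of_real y * indicator (F i -` {y}) x)"
      proof
        fix x
        have "(\<Sum>y\<in>range (F i). complex_of_real y * indicator (F i -` {y}) x)
            = (\<Sum>y\<in>range (F i). if y = F i x then complex_of_real y else 0)"
          by (intro sum.cong) (auto split: split_indicator)
        then show "complex_of_real (F i x)
            = (\<Sum>y\<in>range (F i). of_real y * indicator (F i -` {y}) x)"
          using fin by (simp add: sum.delta)
      qed
      then show ?thesis
        using fin meas by (simp only: trig_approximable_sum trig_approximable_cmult trig_approximable_indicator)
    qed
    show "(\<lambda>i. complex_of_real (F i x)) \<longlonglongrightarrow> of_real (f x)" for x
      by (intro tendsto_of_real F)
    show "norm (complex_of_real (F i x)) \<le> 2 * \<bar>f x\<bar>" for i x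
      using bound by simp
    show "(\<lambda>x. 2 * \<bar>f x\<bar>) \<in> borel_measurable borel"
      using f by measurable
    note [measurable_cong] = M
    note f[measurable]
    have "(\<integral>\<^sup>+x. ennreal ((2 * \<bar>f x\<bar>)\<^sup>2) \<partial>M) = 4 * (\<integral>\<^sup>+x. ennreal ((f x)\<^sup>2) \<partial>M)"
      by (subst nn_integral_cmult[symmetric])
        (auto simp: power_mult_distrib ennreal_mult')
    then show "(\<integral>\<^sup>+x. ennreal ((2 * \<bar>f x\<bar>)\<^sup>2) \<partial>M) < \<infinity>"
      using L2 by (simp add: ennreal_mult_less_top)
  qed
qed

end

section \<open>Positive definite kernels\<close>

text \<open>Real test coefficients are enough for real kernels; complex ones are split into real and
  imaginary parts in \<open>quad_form_nonneg\<close>.\<close>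

definition psd :: "('a \<Rightarrow> 'a \<Rightarrow> real) \<Rightarrow> bool" where
  "psd K \<longleftrightarrow> (\<forall>J a. finite J \<longrightarrow> 0 \<le> (\<Sum>j\<in>J. \<Sum>k\<in>J. a j * a k * K j k))"

lemma psdD: "psd K \<Longrightarrow> finite J \<Longrightarrow> 0 \<le> (\<Sum>j\<in>J. \<Sum>k\<in>J. a j * a k * K j k)"
  by (simp add: psd_def)

lemma psd_one: "psd (\<lambda>_ _. 1)"
  unfolding psd_def
proof (intro allI impI)
  fix J :: "'a set" and a :: "'a \<Rightarrow> real"
  show "0 \<le> (\<Sum>j\<in>J. \<Sum>k\<in>J. a j * a k * 1)"
    using zero_le_square[of "\<Sum>j\<in>J. a j"] by (simp add: sum_product)
qed

lemma psd_scale: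
  assumes "psd K" "0 \<le> c"
  shows "psd (\<lambda>j k. c * K j k)"
  unfolding psd_def
proof (intro allI impI)
  fix J :: "'a set" and a :: "'a \<Rightarrow> real"
  assume "finite J"
  then have "0 \<le> c * (\<Sum>j\<in>J. \<Sum>k\<in>J. a j * a k * K j k)"
    using assms by (intro mult_nonneg_nonneg psdD)
  also have "\<dots> = (\<Sum>j\<in>J. \<Sum>k\<in>J. a j * a k * (c * K j k))"
    unfolding sum_distrib_left by (intro sum.cong refl) (simp add: mult.left_commute)
  finally show "0 \<le> (\<Sum>j\<in>J. \<Sum>k\<in>J. a j * a k * (c * K j k))" .
qed

text \<open>A rank-one factor \<open>b j * b k\<close> only rescales the test coefficients. All
  products of kernels below are built from this elementary case of the Schur product
  theorem.\<close>

lemma psd_congruence: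
  assumes "psd K"
  shows "psd (\<lambda>j k. b j * b k * K j k)"
  unfolding psd_def
proof (intro allI impI)
  fix J :: "'a set" and a :: "'a \<Rightarrow> real"
  assume "finite J"
  from psdD[OF assms this, of "\<lambda>j. a j * b j"]
  show "0 \<le> (\<Sum>j\<in>J. \<Sum>k\<in>J. a j * a k * (b j * b k * K j k))"
    by (simp add: mult_ac)
qed

lemma psd_add:
  assumes "psd K" "psd L"
  shows "psd (\<lambda>j k. K j k + L j k)"
  unfolding psd_def distrib_left sum.distrib
  using assms by (intro allI impI add_nonneg_nonneg psdD)

lemma psd_sum:
  assumes "finite I" "\<And>i. i \<in> I \<Longrightarrow> psd (K i)"
  shows "psd (\<lambda>j k. \<Sum>i\<in>I. K i j k)"
  using assms
proof (induction I rule: finite_induct)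
  case empty
  show ?case by (simp add: psd_def)
next
  case (insert i I)
  then show ?case by (simp add: psd_add)
qed

lemma psd_lim:
  assumes "\<And>n. psd (K n)" and "\<And>j k. (\<lambda>n. K n j k) \<longlonglongrightarrow> L j k"
  shows "psd L"
  unfolding psd_def
proof (intro allI impI)
  fix J :: "'a set" and a :: "'a \<Rightarrow> real"
  assume "finite J"
  have "(\<lambda>n. \<Sum>j\<in>J. \<Sum>k\<in>J. a j * a k * K n j k) \<longlonglongrightarrow> (\<Sum>j\<in>J. \<Sum>k\<in>J. a j * a k * L j k)"
    by (intro tendsto_intros assms)
  then show "0 \<le> (\<Sum>j\<in>J. \<Sum>k\<in>J. a j * a k * L j k)"
    by (rule LIMSEQ_le_const) (use psdD[OF assms(1) \<open>finite J\<close>] in blast)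
qed

lemma psd_integral:
  assumes "\<And>u. psd (K u)" and "\<And>j k. integrable M (\<lambda>u. K u j k)"
  shows "psd (\<lambda>j k. \<integral>u. K u j k \<partial>M)"
  unfolding psd_def
proof (intro allI impI)
  fix J :: "'b set" and a :: "'b \<Rightarrow> real"
  assume "finite J"
  have "0 \<le> (\<integral>u. (\<Sum>j\<in>J. \<Sum>k\<in>J. a j * a k * K u j k) \<partial>M)"
    by (intro integral_nonneg_AE AE_I2 psdD assms \<open>finite J\<close>)
  then show "0 \<le> (\<Sum>j\<in>J. \<Sum>k\<in>J. a j * a k * (\<integral>u. K u j k \<partial>M))"
    by (simp add: integrable_sum integral_sum assms)
qed

text \<open>Asking that multiplication by \<open>B\<close> preserve positive definiteness lets the
  powers of \<open>B\<close> arise by iteration starting from \<open>K\<close>; nonnegative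
  combinations and a limit then give the series.\<close>

lemma psd_power_series:
  assumes B: "\<And>K. psd K \<Longrightarrow> psd (\<lambda>j k. B j k * K j k)"
    and a: "\<And>m. 0 \<le> a m" and g: "\<And>x::real. (\<lambda>m. a m * x ^ m) sums g x" and K: "psd K"
  shows "psd (\<lambda>j k. g (B j k) * K j k)"
proof (rule psd_lim)
  have power: "psd (\<lambda>j k. B j k ^ m * K j k)" for m
  proof (induction m)
    case (Suc m)
    from B[OF this] show ?case by (simp add: mult_ac)
  qed (simp add: K)
  show "psd (\<lambda>j k. \<Sum>m<n. a m * (B j k ^ m * K j k))" for n
    by (intro psd_sum psd_scale power a) simp
  show "(\<lambda>n. \<Sum>m<n. a m * (B j k ^ m * K j k)) \<longlonglongrightarrow> g (B j k) * K j k" for j k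
    using sums_mult2[OF g[of "B j k"], of "K j k"] by (simp add: sums_def sum_distrib_right mult.assoc)
qed

section \<open>Hermitian forms of real kernels\<close>

definition quad_form :: "('a \<Rightarrow> 'a \<Rightarrow> real) \<Rightarrow> 'a set \<Rightarrow> ('a \<Rightarrow> complex) \<Rightarrow> real" where
  "quad_form K J c = (\<Sum>j\<in>J. \<Sum>k\<in>J. Re (c j * cnj (c k)) * K j k)"

text \<open>\<open>Re (c j * cnj (c k))\<close> equals
  \<open>Re (c j) * Re (c k) + Im (c j) * Im (c k)\<close>, so the form is a sum of two real
  ones.\<close>

lemma quad_form_nonneg:
  assumes "psd K" "finite J"
  shows "0 \<le> quad_form K J c"
proof -
  have "quad_form K J c = (\<Sum>j\<in>J. \<Sum>k\<in>J. Re (c j) * Re (c k) * K j k)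
      + (\<Sum>j\<in>J. \<Sum>k\<in>J. Im (c j) * Im (c k) * K j k)"
    unfolding quad_form_def sum.distrib[symmetric]
    by (intro sum.cong refl) (simp add: algebra_simps)
  then show ?thesis
    by (simp add: psdD assms)
qed

lemma quad_form_add: "quad_form (\<lambda>j k. K j k + L j k) J c = quad_form K J c + quad_form L J c"
  unfolding quad_form_def sum.distrib[symmetric]
  by (intro sum.cong refl) (simp add: algebra_simps)

lemma quad_form_mono:
  assumes "psd (\<lambda>j k. L j k - K j k)" "finite J"
  shows "quad_form K J c \<le> quad_form L J c"
  using quad_form_nonneg[OF assms, of c] quad_form_add[of K "\<lambda>j k. L j k - K j k" J c] by simp

lemma quad_form_parallelogram:
  "quad_form K J (\<lambda>j. c j + d j) + quad_form K J (\<lambda>j. c j - d j)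
    = 2 * quad_form K J c + 2 * quad_form K J d"
  unfolding quad_form_def sum_distrib_left sum.distrib[symmetric]
  by (intro sum.cong refl) (simp add: algebra_simps)

text \<open>The parallelogram identity for \<open>d\<close> and \<open>c - d\<close>, whose sum is
  \<open>c\<close>, after dropping the nonnegative form of their difference.\<close>

lemma quad_form_triangle:
  assumes "psd K" "finite J"
  shows "quad_form K J c \<le> 2 * quad_form K J d + 2 * quad_form K J (\<lambda>j. c j - d j)"
  using quad_form_parallelogram[of K J d "\<lambda>j. c j - d j"]
    quad_form_nonneg[OF assms, of "\<lambda>j. d j - (c j - d j)"] by simp

section \<open>Levy densities, their exponents and their kernels\<close>

definition levy_weight :: "('a::euclidean_space \<Rightarrow> real) \<Rightarrow> bool" where
  "levy_weight h \<longleftrightarrow> h \<in> borel_measurable borel \<and> (\<forall>u. 0 \<le> h u) \<and>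
     (\<forall>\<xi>. integrable lborel (\<lambda>u. (1 - cos (\<xi> \<bullet> u)) * h u))"

text \<open>This is the exponent \<open>\<psi>\<close>. It contains cosines only because it is used
  with even densities, for which the sine part of the Levy-Khintchine integral cancels.\<close>

definition levy_exp :: "('a::euclidean_space \<Rightarrow> real) \<Rightarrow> 'a \<Rightarrow> real" where
  "levy_exp h \<xi> = (\<integral>u. (1 - cos (\<xi> \<bullet> u)) * h u \<partial>lborel)"

definition levy_kernel :: "('a::euclidean_space \<Rightarrow> real) \<Rightarrow> 'a \<Rightarrow> 'a \<Rightarrow> real" where
  "levy_kernel h j k = levy_exp h j + levy_exp h k - levy_exp h (j - k)"

lemma levy_exp_0 [simp]: "levy_exp h 0 = 0"
  by (simp add: levy_exp_def)

text \<open>The left side is the real part of \<open>(exp (i a) - 1) * cnj (exp (i b) - 1)\<close>;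
  integrated over the jumps it exhibits \<open>levy_kernel\<close> as a Gram kernel.\<close>

lemma cos_minus_one_mult:
  fixes a b :: real
  shows "(cos a - 1) * (cos b - 1) + sin a * sin b
    = (1 - cos a) + (1 - cos b) - (1 - cos (a - b))"
  by (simp add: cos_diff algebra_simps)

lemma levy_kernel_integral:
  assumes "levy_weight h"
  shows "integrable lborel (\<lambda>u. ((cos (j \<bullet> u) - 1) * (cos (k \<bullet> u) - 1) + sin (j \<bullet> u) * sin (k \<bullet> u)) * h u)"
    (is "integrable _ ?f")
    and "levy_kernel h j k
      = (\<integral>u. ((cos (j \<bullet> u) - 1) * (cos (k \<bullet> u) - 1) + sin (j \<bullet> u) * sin (k \<bullet> u)) * h u \<partial>lborel)"
proof -
  have i: "integrable lborel (\<lambda>u. (1 - cos (\<xi> \<bullet> u)) * h u)" for \<xi>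
    using assms by (simp add: levy_weight_def)
  have eq: "?f u = (1 - cos (j \<bullet> u)) * h u + (1 - cos (k \<bullet> u)) * h u - (1 - cos ((j - k) \<bullet> u)) * h u" for u
    unfolding cos_minus_one_mult inner_diff_left by (simp add: algebra_simps)
  show "integrable lborel ?f"
    unfolding eq by (intro Bochner_Integration.integrable_diff Bochner_Integration.integrable_add i)
  show "levy_kernel h j k = integral\<^sup>L lborel ?f"
    unfolding eq levy_kernel_def levy_exp_def by (simp add: i)
qed

text \<open>At each \<open>u\<close> the integrand of \<open>levy_kernel\<close> is
  \<open>h u\<close> times a sum of two rank-one kernels, one from cosines and one from sines.
  Multiplication by it is a nonnegative combination of congruences, and integration over
  \<open>u\<close> preserves positivity.\<close>

lemma psd_levy_kernel_mult:
  assumes h: "levy_weight h" and K: "psd K"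
  shows "psd (\<lambda>j k. levy_kernel h j k * K j k)"
proof -
  let ?f = "\<lambda>u j k. ((cos (j \<bullet> u) - 1) * (cos (k \<bullet> u) - 1) + sin (j \<bullet> u) * sin (k \<bullet> u)) * h u"
  have "psd (\<lambda>j k. \<integral>u. ?f u j k * K j k \<partial>lborel)"
  proof (rule psd_integral)
    fix u
    have "psd (\<lambda>j k. h u * ((cos (j \<bullet> u) - 1) * (cos (k \<bullet> u) - 1) * K j k + sin (j \<bullet> u) * sin (k \<bullet> u) * K j k))"
      using h by (intro psd_scale psd_add psd_congruence K) (simp add: levy_weight_def)
    then show "psd (\<lambda>j k. ?f u j k * K j k)"
      by (simp add: algebra_simps)
    show "integrable lborel (\<lambda>u. ?f u j k * K j k)" for j k
      by (intro integrable_mult_left levy_kernel_integral h)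
  qed
  then show ?thesis
    by (simp add: levy_kernel_integral(2)[OF h])
qed

text \<open>
  All three functions of the Levy kernel are power series with nonnegative coefficients; the last
  one, \<open>x exp x - exp x + 1\<close>, carries the Poincare inequality.
\<close>

lemma psd_exp_levy_kernel:
  assumes h: "levy_weight h" and K: "psd K"
  shows "psd (\<lambda>j k. exp (levy_kernel h j k) * K j k)"
    and "psd (\<lambda>j k. (exp (levy_kernel h j k) - 1) * K j k)"
    and "psd (\<lambda>j k. (exp (levy_kernel h j k) * (levy_kernel h j k - 1) + 1) * K j k)"
proof -
  let ?e = "\<lambda>m. inverse (fact m) :: real"
  have exp: "(\<lambda>m. ?e m * x ^ m) sums exp x" for x :: real
    using exp_converges[of x] by simp
  have one: "(\<lambda>m. (if m = 0 then 1 else 0) * x ^ m) sums 1" for x :: real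
    using sums_single[of 0 "\<lambda>m. x ^ m"] by (simp add: if_distrib[of "\<lambda>a. a * _"] cong: if_cong)
  have xexp: "(\<lambda>m. (if m = 0 then 0 else ?e (m - 1)) * x ^ m) sums (x * exp x)" for x :: real
    using sums_mult[OF exp[of x], of x]
      sums_Suc_iff[of "\<lambda>m. (if m = 0 then 0 else ?e (m - 1)) * x ^ m" "x * exp x"]
    by (simp add: mult_ac)
  have series: "psd (\<lambda>j k. g (levy_kernel h j k) * K j k)"
    if "\<And>m. 0 \<le> a m" "\<And>x. (\<lambda>m. a m * x ^ m) sums g x" for a g
    by (rule psd_power_series[OF psd_levy_kernel_mult[OF h] that K])
  show "psd (\<lambda>j k. exp (levy_kernel h j k) * K j k)"
    by (rule series[where a = ?e and g = exp, OF _ exp]) simp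
  let ?b = "\<lambda>m. ?e m - (if m = 0 then 1 else 0)"
  have b: "(\<lambda>m. ?b m * x ^ m) sums (exp x - 1)" for x :: real
    using sums_diff[OF exp one, of x] by (simp only: left_diff_distrib)
  show "psd (\<lambda>j k. (exp (levy_kernel h j k) - 1) * K j k)"
    by (rule series[where a = ?b and g = "\<lambda>x. exp x - 1", OF _ b]) simp
  \<comment> \<open>The coefficient of \<open>x ^ m\<close> in \<open>x * exp x - exp x + 1\<close>:
    it is \<open>1 / (m - 1)! - 1 / m!\<close> for \<open>m \<ge> 1\<close>, and
    \<open>0 - 1 + 1 = 0\<close> for \<open>m = 0\<close>, where the case distinction keeps the
    truncated \<open>m - 1\<close> out.\<close>
  let ?a = "\<lambda>m. ((if m = 0 then 0 else ?e (m - 1)) - ?e m) + (if m = 0 then 1 else 0)"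
  have "(\<lambda>m. ?a m * x ^ m) sums (x * exp x - exp x + 1)" for x :: real
    using sums_add[OF sums_diff[OF xexp exp] one, of x x] by (simp only: distrib_right left_diff_distrib)
  moreover have eq: "x * exp x - exp x + 1 = exp x * (x - 1) + 1" for x :: real
    by (simp add: algebra_simps)
  ultimately have a: "(\<lambda>m. ?a m * x ^ m) sums (exp x * (x - 1) + 1)" for x :: real
    by (simp only: eq)
  have a_nonneg: "0 \<le> ?a m" for m
  proof (cases m)
    case (Suc n)
    have "?e (Suc n) \<le> ?e n"
      by (intro le_imp_inverse_le fact_mono) auto
    with Suc show ?thesis by (simp del: fact_Suc)
  qed simp
  show "psd (\<lambda>j k. (exp (levy_kernel h j k) * (levy_kernel h j k - 1) + 1) * K j k)"
    by (rule series[where a = ?a and g = "\<lambda>x. exp x * (x - 1) + 1", OF a_nonneg a])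
qed

section \<open>The Poincare inequality\<close>

text \<open>Reflection preserves Lebesgue measure, so the integral equals its own negative; for a
  function that is not integrable this agrees with the default value \<open>0\<close>.\<close>

lemma lborel_integral_odd:
  fixes g :: "'a::euclidean_space \<Rightarrow> real"
  assumes "g \<in> borel_measurable borel" "\<And>u. g (- u) = - g u"
  shows "(\<integral>u. g u \<partial>lborel) = 0"
proof -
  have "lborel = distr lborel borel (\<lambda>u::'a. - u)"
    using lborel_affine[of "-1" "0::'a"] by (simp add: density_1)
  then have "(\<integral>u. g u \<partial>lborel) = (\<integral>u. g u \<partial>distr lborel borel (\<lambda>u. - u))"
    by simp
  also have "\<dots> = (\<integral>u. g (- u) \<partial>lborel)"
    using assms(1) by (intro integral_distr) auto
  finally show ?thesis
    by (simp add: assms(2))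
qed

lemma levy_weight_mono:
  assumes \<rho>: "levy_weight \<rho>" and h: "h \<in> borel_measurable borel" "\<And>u. 0 \<le> h u" "\<And>u. h u \<le> \<rho> u"
  shows "levy_weight h"
  unfolding levy_weight_def
proof (intro conjI h allI)
  note [measurable] = h(1)
  fix \<xi>
  have "integrable lborel (\<lambda>u. (1 - cos (\<xi> \<bullet> u)) * \<rho> u)"
    using \<rho> by (simp add: levy_weight_def)
  then show "integrable lborel (\<lambda>u. (1 - cos (\<xi> \<bullet> u)) * h u)"
    by (rule Bochner_Integration.integrable_bound)
      (auto intro!: mult_left_mono simp: h abs_mult order_trans[OF h(2,3)])
qed

lemma norm_iexp_minus_one: "(norm (iexp t - 1))\<^sup>2 = 2 * (1 - cos t)"
proof -
  have "(norm (iexp t - 1))\<^sup>2 = (cos t - 1)\<^sup>2 + (sin t)\<^sup>2"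
    by (simp add: cmod_power2 Re_exp Im_exp)
  then show ?thesis
    using sin_cos_squared_add[of t] by (simp add: power2_eq_square algebra_simps)
qed

lemma norm_mult_le_square_mean: "norm (a * b :: complex) \<le> ((norm a)\<^sup>2 + (norm b)\<^sup>2) / 2"
  using zero_le_power2[of "norm a - norm b"] by (simp add: norm_mult power2_eq_square algebra_simps)

text \<open>A complex factor \<open>a\<close> brings in the imaginary part of the Gram integrand.
  That part is odd in \<open>u\<close>, so it integrates to \<open>0\<close> against an even
  density, and only \<open>Re a\<close> times \<open>levy_kernel\<close> survives.\<close>

lemma levy_kernel_iexp:
  assumes h: "levy_weight h" and even: "\<And>u. h (- u) = h u"
  shows "integrable lborel (\<lambda>u. Re (a * ((iexp (j \<bullet> u) - 1) * cnj (iexp (k \<bullet> u) - 1))) * h u)" (is ?i)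
    and "(\<integral>u. Re (a * ((iexp (j \<bullet> u) - 1) * cnj (iexp (k \<bullet> u) - 1))) * h u \<partial>lborel)
      = Re a * levy_kernel h j k" (is ?e)
proof -
  have [measurable]: "h \<in> borel_measurable borel" and nn: "\<And>u. 0 \<le> h u"
    using h by (auto simp: levy_weight_def)
  let ?z = "\<lambda>u. (iexp (j \<bullet> u) - 1) * cnj (iexp (k \<bullet> u) - 1)"
  have Re: "Re (?z u) = (cos (j \<bullet> u) - 1) * (cos (k \<bullet> u) - 1) + sin (j \<bullet> u) * sin (k \<bullet> u)" for u
    by (simp add: Re_exp Im_exp)
  have Im: "Im (?z u) = sin (j \<bullet> u) * (cos (k \<bullet> u) - 1) - (cos (j \<bullet> u) - 1) * sin (k \<bullet> u)" for u
    by (simp add: Re_exp Im_exp)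
  have i1: "integrable lborel (\<lambda>u. Re (?z u) * h u)"
    unfolding Re by (rule levy_kernel_integral[OF h])
  have i2: "integrable lborel (\<lambda>u. Im (?z u) * h u)"
  proof (rule Bochner_Integration.integrable_bound)
    show "integrable lborel (\<lambda>u. (1 - cos (j \<bullet> u)) * h u + (1 - cos (k \<bullet> u)) * h u)"
      using h by (intro Bochner_Integration.integrable_add) (auto simp: levy_weight_def)
    \<comment> \<open>The product of two increments is bounded by the mean of their squared moduli,
      and \<open>norm (exp (i t) - 1)\<close> has square \<open>2 * (1 - cos t)\<close>; hence the
      integrability in \<open>levy_weight\<close> also covers the imaginary part.\<close>
    have "\<bar>Im (?z u)\<bar> \<le> (1 - cos (j \<bullet> u)) + (1 - cos (k \<bullet> u))" for u
      using abs_Im_le_cmod[of "?z u"] norm_mult_le_square_mean[of "iexp (j \<bullet> u) - 1" "cnj (iexp (k \<bullet> u) - 1)"]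
      unfolding complex_mod_cnj norm_iexp_minus_one by simp
    then have le: "norm (Im (?z u) * h u) \<le> ((1 - cos (j \<bullet> u)) + (1 - cos (k \<bullet> u))) * h u" for u
      unfolding abs_mult real_norm_def abs_of_nonneg[OF nn] by (intro mult_right_mono nn)
    show "AE u in lborel. norm (Im (?z u) * h u)
        \<le> norm ((1 - cos (j \<bullet> u)) * h u + (1 - cos (k \<bullet> u)) * h u)"
      using le unfolding distrib_right real_norm_def by (intro AE_I2 order_trans[OF _ abs_ge_self])
  qed (simp add: Im)
  have eq: "Re (a * ?z u) * h u = Re a * (Re (?z u) * h u) - Im a * (Im (?z u) * h u)" for u
    by (simp add: left_diff_distrib mult.assoc)
  show ?i
    unfolding eq by (intro Bochner_Integration.integrable_diff integrable_mult_right i1 i2)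
  have "(\<integral>u. Im (?z u) * h u \<partial>lborel) = 0"
    unfolding Im by (rule lborel_integral_odd) (auto simp: even algebra_simps)
  moreover have "(\<integral>u. Re (?z u) * h u \<partial>lborel) = levy_kernel h j k"
    unfolding Re by (rule levy_kernel_integral(2)[OF h, symmetric])
  moreover have "(\<integral>u. r * F u - s * G u \<partial>lborel) = r * (\<integral>u. F u \<partial>lborel) - s * (\<integral>u. G u \<partial>lborel)"
    if "integrable lborel F" "integrable lborel G" for F G :: "'a \<Rightarrow> real" and r s
    using that by simp
  from this[OF i1 i2, of "Re a" "Im a"]
  have "(\<integral>u. Re (a * ?z u) * h u \<partial>lborel)
      = Re a * (\<integral>u. Re (?z u) * h u \<partial>lborel) - Im a * (\<integral>u. Im (?z u) * h u \<partial>lborel)"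
    unfolding eq .
  ultimately show ?e by (simp only: mult_zero_right diff_zero)
qed

text \<open>Complex \<open>g\<close> and a free density \<open>h\<close> let one functional measure
  both trigonometric polynomials and truncated jumps. The stable energy is the case of real
  \<open>g\<close> with the stable density.\<close>

definition jump_energy :: "'a::euclidean_space measure \<Rightarrow> ('a \<Rightarrow> real) \<Rightarrow> ('a \<Rightarrow> complex) \<Rightarrow> ennreal" where
  "jump_energy \<mu> h g = (\<integral>\<^sup>+x. (\<integral>\<^sup>+u. ennreal ((norm (g (x + u) - g x))\<^sup>2 * h u) \<partial>lborel) \<partial>\<mu>)"

text \<open>Symmetric infinitely divisible laws of pure jump type. The Poincare inequality with
  constant \<open>1\<close> is proved at this level; the stable law is a special choice of
  \<open>\<rho>\<close> made only at the end.\<close>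

locale symmetric_jump_law = prob_space \<mu> for \<mu> :: "'a::euclidean_space measure" +
  fixes \<rho> :: "'a \<Rightarrow> real"
  assumes sets_eq [measurable_cong]: "sets \<mu> = sets borel"
    and weight: "levy_weight \<rho>" and even: "\<And>u. \<rho> (- u) = \<rho> u"
    and char: "\<And>\<xi>. char_fun \<mu> \<xi> = complex_of_real (exp (- levy_exp \<rho> \<xi>))"
begin

section \<open>Variance and jump energy as quadratic forms in the coefficients\<close>

definition \<phi> :: "'a \<Rightarrow> real" where
  "\<phi> \<xi> = exp (- levy_exp \<rho> \<xi>)"

lemma \<rho>_measurable [measurable]: "\<rho> \<in> borel_measurable borel"
  using weight by (simp add: levy_weight_def)

lemma \<rho>_nonneg: "0 \<le> \<rho> u"
  using weight by (simp add: levy_weight_def)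

lemma iexp_integral:
  shows "integrable \<mu> (\<lambda>x. iexp (j \<bullet> x))" and "(\<integral>x. iexp (j \<bullet> x) \<partial>\<mu>) = \<phi> j"
proof -
  show "integrable \<mu> (\<lambda>x. iexp (j \<bullet> x))"
    by (rule integrable_const_bound[of _ 1]) auto
  show "(\<integral>x. iexp (j \<bullet> x) \<partial>\<mu>) = \<phi> j"
    using char[of j] by (simp add: char_fun_def \<phi>_def)
qed

lemma trig_sum_integral:
  shows "integrable \<mu> (trig_sum J c)" and "(\<integral>x. trig_sum J c x \<partial>\<mu>) = (\<Sum>j\<in>J. c j * \<phi> j)"
  by (simp_all add: trig_sum_def[abs_def] iexp_integral)

lemma norm_trig_sum:
  "complex_of_real ((norm (trig_sum J c x))\<^sup>2)
    = (\<Sum>j\<in>J. \<Sum>k\<in>J. c j * cnj (c k) * iexp ((j - k) \<bullet> x))"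
  unfolding complex_norm_square trig_sum_def cnj_sum sum_product
  by (intro sum.cong refl) (simp add: exp_cnj inner_diff_left right_diff_distrib exp_diff exp_minus field_simps)

lemma trig_sum_L2:
  shows "integrable \<mu> (\<lambda>x. (norm (trig_sum J c x))\<^sup>2)"
    and "(\<integral>x. (norm (trig_sum J c x))\<^sup>2 \<partial>\<mu>) = quad_form (\<lambda>j k. \<phi> (j - k)) J c"
proof -
  have eq: "(norm (trig_sum J c x))\<^sup>2 = Re (\<Sum>j\<in>J. \<Sum>k\<in>J. c j * cnj (c k) * iexp ((j - k) \<bullet> x))" for x
    using norm_trig_sum[of J c x] by (metis Re_complex_of_real)
  have i: "integrable \<mu> (\<lambda>x. \<Sum>j\<in>J. \<Sum>k\<in>J. c j * cnj (c k) * iexp ((j - k) \<bullet> x))"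
    by (intro Bochner_Integration.integrable_sum integrable_mult_right iexp_integral)
  then show "integrable \<mu> (\<lambda>x. (norm (trig_sum J c x))\<^sup>2)"
    unfolding eq by (rule integrable_Re)
  have "(\<integral>x. (norm (trig_sum J c x))\<^sup>2 \<partial>\<mu>)
      = Re (\<integral>x. (\<Sum>j\<in>J. \<Sum>k\<in>J. c j * cnj (c k) * iexp ((j - k) \<bullet> x)) \<partial>\<mu>)"
    unfolding eq using i by (rule integral_Re)
  also have "\<dots> = Re (\<Sum>j\<in>J. \<Sum>k\<in>J. c j * cnj (c k) * \<phi> (j - k))"
    by (simp add: Bochner_Integration.integral_sum iexp_integral)
  finally show "(\<integral>x. (norm (trig_sum J c x))\<^sup>2 \<partial>\<mu>) = quad_form (\<lambda>j k. \<phi> (j - k)) J c"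
    by (simp add: quad_form_def)
qed

lemma trig_sum_nn_L2:
  "(\<integral>\<^sup>+x. ennreal ((norm (trig_sum J c x))\<^sup>2) \<partial>\<mu>) = ennreal (quad_form (\<lambda>j k. \<phi> (j - k)) J c)"
  by (subst nn_integral_eq_integral[OF trig_sum_L2(1)]) (simp_all add: trig_sum_L2(2))

lemma trig_sum_variance:
  "(\<integral>\<^sup>+x. ennreal ((norm (trig_sum J c x - (\<Sum>j\<in>J. c j * \<phi> j)))\<^sup>2) \<partial>\<mu>)
    = ennreal (quad_form (\<lambda>j k. \<phi> (j - k) - \<phi> j * \<phi> k) J c)"
proof -
  define m where "m = (\<Sum>j\<in>J. c j * \<phi> j)"
  have eq: "(norm (z - m))\<^sup>2 = (norm z)\<^sup>2 - 2 * Re (cnj m * z) + (norm m)\<^sup>2" for z :: complex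
    unfolding cmod_power2 by (simp add: power2_eq_square algebra_simps)
  have i: "integrable \<mu> (\<lambda>x. Re (cnj m * trig_sum J c x))"
    by (intro integrable_Re integrable_mult_right trig_sum_integral)
  have "(\<integral>x. Re (cnj m * trig_sum J c x) \<partial>\<mu>) = Re (\<integral>x. cnj m * trig_sum J c x \<partial>\<mu>)"
    by (intro integral_Re integrable_mult_right trig_sum_integral)
  also have "\<dots> = Re (cnj m * m)"
    by (simp add: trig_sum_integral m_def)
  also have "\<dots> = (norm m)\<^sup>2"
    unfolding cmod_power2 by (simp add: power2_eq_square)
  finally have Re: "(\<integral>x. Re (cnj m * trig_sum J c x) \<partial>\<mu>) = (norm m)\<^sup>2" .
  have "complex_of_real ((norm m)\<^sup>2) = (\<Sum>j\<in>J. \<Sum>k\<in>J. c j * cnj (c k) * (\<phi> j * \<phi> k))"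
    unfolding complex_norm_square m_def cnj_sum sum_product
    by (intro sum.cong refl) (simp add: mult_ac)
  then have m: "(norm m)\<^sup>2 = quad_form (\<lambda>j k. \<phi> j * \<phi> k) J c"
    unfolding quad_form_def by (simp add: complex_eq_iff)
  have quad: "quad_form (\<lambda>j k. \<phi> (j - k) - \<phi> j * \<phi> k) J c = quad_form (\<lambda>j k. \<phi> (j - k)) J c - (norm m)\<^sup>2"
    unfolding m quad_form_def sum_subtractf[symmetric] by (intro sum.cong refl) (simp add: algebra_simps)
  define R where "R x = Re (cnj m * trig_sum J c x)" for x
  note eq = eq[of "trig_sum J c _", folded R_def]
  have int: "integrable \<mu> (\<lambda>x. (norm (trig_sum J c x - m))\<^sup>2)"
    unfolding eq using i[folded R_def] trig_sum_L2(1)[of J c] by simp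
  have "(\<integral>x. (norm (trig_sum J c x - m))\<^sup>2 \<partial>\<mu>) = quad_form (\<lambda>j k. \<phi> (j - k) - \<phi> j * \<phi> k) J c"
    unfolding eq quad using i[folded R_def] trig_sum_L2(1)[of J c] Re[folded R_def]
    by (simp add: trig_sum_L2(2) prob_space)
  then show ?thesis
    unfolding m_def[symmetric] using nn_integral_eq_integral[OF int] by simp
qed

text \<open>For a fixed jump \<open>u\<close> the increment is again a trigonometric sum, with
  coefficients \<open>c j * (iexp (j \<bullet> u) - 1)\<close>, so its L2 norm is a form in
  \<open>\<phi> (j - k)\<close>. Integrating over \<open>u\<close> after Tonelli turns the products
  of the new factors into \<open>levy_kernel h j k\<close>.\<close>

lemma jump_energy_trig_sum:
  assumes h: "levy_weight h" and even_h: "\<And>u. h (- u) = h u"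
  shows "jump_energy \<mu> h (trig_sum J c) = ennreal (quad_form (\<lambda>j k. \<phi> (j - k) * levy_kernel h j k) J c)"
proof -
  interpret P: pair_sigma_finite \<mu> lborel ..
  have [measurable]: "h \<in> borel_measurable borel" and nn: "\<And>u. 0 \<le> h u"
    using h by (auto simp: levy_weight_def)
  have [measurable]: "trig_sum J c \<in> borel_measurable borel"
    by (simp add: trig_sum_def[abs_def])
  let ?d = "\<lambda>u j. c j * (iexp (j \<bullet> u) - 1)"
  let ?q = "\<lambda>u. quad_form (\<lambda>j k. \<phi> (j - k)) J (?d u)"
  have diff: "trig_sum J c (x + u) - trig_sum J c x = trig_sum J (?d u) x" for x u
    by (simp add: trig_sum_def sum_subtractf[symmetric] inner_add_right distrib_left exp_add algebra_simps)
  have q_nonneg: "0 \<le> ?q u" for u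
    unfolding trig_sum_L2(2)[symmetric] by simp
  have q: "?q u * h u = (\<Sum>j\<in>J. \<Sum>k\<in>J. \<phi> (j - k) *
      (Re ((c j * cnj (c k)) * ((iexp (j \<bullet> u) - 1) * cnj (iexp (k \<bullet> u) - 1))) * h u))" for u
    unfolding quad_form_def sum_distrib_right
    by (intro sum.cong refl) (simp only: complex_cnj_mult mult_ac)
  have ti: "integrable lborel (\<lambda>u. \<phi> (j - k) *
      (Re ((c j * cnj (c k)) * ((iexp (j \<bullet> u) - 1) * cnj (iexp (k \<bullet> u) - 1))) * h u))" for j k
    by (intro integrable_mult_right levy_kernel_iexp h even_h)
  have int: "integrable lborel (\<lambda>u. ?q u * h u)"
    unfolding q by (intro Bochner_Integration.integrable_sum ti)
  have "(\<integral>u. ?q u * h u \<partial>lborel) = (\<Sum>j\<in>J. \<Sum>k\<in>J. \<phi> (j - k) * (Re (c j * cnj (c k)) * levy_kernel h j k))"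
    unfolding q
    by (simp only: Bochner_Integration.integral_sum Bochner_Integration.integrable_sum ti
        integral_mult_right_zero levy_kernel_iexp(2)[OF h even_h])
  then have val: "(\<integral>u. ?q u * h u \<partial>lborel) = quad_form (\<lambda>j k. \<phi> (j - k) * levy_kernel h j k) J c"
    by (simp add: quad_form_def mult_ac)
  have "jump_energy \<mu> h (trig_sum J c)
      = (\<integral>\<^sup>+u. (\<integral>\<^sup>+x. ennreal ((norm (trig_sum J c (x + u) - trig_sum J c x))\<^sup>2 * h u) \<partial>\<mu>) \<partial>lborel)"
    unfolding jump_energy_def by (rule P.Fubini'[symmetric]) measurable
  also have "\<dots> = (\<integral>\<^sup>+u. ennreal (?q u * h u) \<partial>lborel)"
  proof (intro nn_integral_cong)
    fix u
    have "(\<integral>\<^sup>+x. ennreal ((norm (trig_sum J c (x + u) - trig_sum J c x))\<^sup>2 * h u) \<partial>\<mu>)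
        = (\<integral>\<^sup>+x. ennreal ((norm (trig_sum J (?d u) x))\<^sup>2) \<partial>\<mu>) * ennreal (h u)"
      unfolding diff using nn
      by (subst nn_integral_multc[symmetric]) (auto simp: ennreal_mult'' trig_sum_def)
    also have "\<dots> = ennreal (?q u * h u)"
      unfolding trig_sum_nn_L2 using nn by (simp add: ennreal_mult'')
    finally show "(\<integral>\<^sup>+x. ennreal ((norm (trig_sum J c (x + u) - trig_sum J c x))\<^sup>2 * h u) \<partial>\<mu>)
        = ennreal (?q u * h u)" .
  qed
  also have "\<dots> = ennreal (\<integral>u. ?q u * h u \<partial>lborel)"
    by (rule nn_integral_eq_integral[OF int]) (use q_nonneg nn in auto)
  finally show ?thesis
    unfolding val .
qed

section \<open>Splitting the jump density into a part \<open>h\<close> and a remainder\<close>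

context
  fixes h :: "'a \<Rightarrow> real"
  assumes h_meas [measurable]: "h \<in> borel_measurable borel"
    and h_nonneg: "\<And>u. 0 \<le> h u" and h_le: "\<And>u. h u \<le> \<rho> u"
begin

lemma weight_below: "levy_weight h"
  by (rule levy_weight_mono[OF weight h_meas h_nonneg h_le])

lemma weight_remainder: "levy_weight (\<lambda>u. \<rho> u - h u)"
  by (rule levy_weight_mono[OF weight]) (auto simp: h_nonneg h_le)

lemma levy_exp_split: "levy_exp \<rho> \<xi> = levy_exp h \<xi> + levy_exp (\<lambda>u. \<rho> u - h u) \<xi>"
proof -
  have "integrable lborel (\<lambda>u. (1 - cos (\<xi> \<bullet> u)) * h u)"
    "integrable lborel (\<lambda>u. (1 - cos (\<xi> \<bullet> u)) * (\<rho> u - h u))"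
    using weight_below weight_remainder by (simp_all add: levy_weight_def)
  from Bochner_Integration.integral_add[OF this] show ?thesis
    by (simp add: levy_exp_def algebra_simps)
qed

text \<open>
  The part of the variance form \<open>\<phi> (j - k) - \<phi> j * \<phi> k\<close> contributed by the jumps that \<open>h\<close> misses.
\<close>

definition remainder_kernel :: "'a \<Rightarrow> 'a \<Rightarrow> real" where
  "remainder_kernel j k = \<phi> j * \<phi> k * (exp (levy_kernel (\<lambda>u. \<rho> u - h u) j k) - 1)"

text \<open>The exponent is additive in the density, hence so is \<open>levy_kernel\<close>; the
  factors \<open>\<phi> j * \<phi> k\<close> absorb the exponents at \<open>j\<close> and
  \<open>k\<close> themselves.\<close>

lemma \<phi>_diff:
  "\<phi> (j - k) = \<phi> j * \<phi> k * (exp (levy_kernel h j k) * exp (levy_kernel (\<lambda>u. \<rho> u - h u) j k))"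
  unfolding \<phi>_def levy_kernel_def levy_exp_split[of j] levy_exp_split[of k] levy_exp_split[of "j - k"]
  by (simp flip: exp_add)

lemma psd_remainder_kernel: "psd remainder_kernel"
  using psd_congruence[OF psd_exp_levy_kernel(2)[OF weight_remainder psd_one], of \<phi>]
  by (simp add: remainder_kernel_def[abs_def])

text \<open>Up to the factor \<open>\<phi> j * \<phi> k\<close> the kernel is
  \<open>(exp B_h - 1) * exp B_r + 1\<close>, with \<open>B_h\<close> and \<open>B_r\<close> the
  Levy kernels of \<open>h\<close> and of the remainder. Consequently the remainder form never
  exceeds the squared L2 norm, whatever \<open>h\<close> is.\<close>

lemma psd_remainder_kernel_le: "psd (\<lambda>j k. \<phi> (j - k) - remainder_kernel j k)"
proof -
  let ?r = "levy_kernel (\<lambda>u. \<rho> u - h u)"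
  have "psd (\<lambda>j k. (exp (levy_kernel h j k) - 1) * (exp (?r j k) * 1) + 1)"
    by (intro psd_add psd_one psd_exp_levy_kernel weight_below weight_remainder)
  from psd_congruence[OF this, of \<phi>] show ?thesis
    by (simp add: remainder_kernel_def \<phi>_diff algebra_simps)
qed

text \<open>With \<open>B_h\<close> and \<open>B_r\<close> as above and up to the factor
  \<open>\<phi> j * \<phi> k\<close>, the kernel factorises as
  \<open>(B_h * exp B_h - exp B_h + 1) * exp B_r\<close>. The constant \<open>1\<close> in front of
  the energy is thus kept although only the jumps in \<open>h\<close> are charged.\<close>

lemma psd_poincare_kernel:
  "psd (\<lambda>j k. (\<phi> (j - k) * levy_kernel h j k + remainder_kernel j k) - (\<phi> (j - k) - \<phi> j * \<phi> k))"
proof -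
  let ?r = "levy_kernel (\<lambda>u. \<rho> u - h u)"
  have "psd (\<lambda>j k. (exp (levy_kernel h j k) * (levy_kernel h j k - 1) + 1) * (exp (?r j k) * 1))"
    by (intro psd_one psd_exp_levy_kernel weight_below weight_remainder)
  from psd_congruence[OF this, of \<phi>] show ?thesis
    by (simp add: remainder_kernel_def \<phi>_diff algebra_simps)
qed

lemma quad_form_variance_le:
  assumes "finite J"
  shows "quad_form (\<lambda>j k. \<phi> (j - k) - \<phi> j * \<phi> k) J c
    \<le> quad_form (\<lambda>j k. \<phi> (j - k) * levy_kernel h j k) J c + quad_form remainder_kernel J c"
  using quad_form_mono[OF psd_poincare_kernel assms, of c] by (simp add: quad_form_add)

end

section \<open>Truncated densities and approximation in energy\<close>

definition truncation :: "nat \<Rightarrow> 'a \<Rightarrow> real" where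
  "truncation n u = min (\<rho> u) (real n) * indicator (cball 0 (real n)) u"

lemma truncation_measurable [measurable]: "truncation n \<in> borel_measurable borel"
  unfolding truncation_def[abs_def]
  by (intro borel_measurable_times borel_measurable_min borel_measurable_indicator) auto

lemma truncation_nonneg: "0 \<le> truncation n u"
  by (simp add: truncation_def \<rho>_nonneg)

lemma truncation_le: "truncation n u \<le> \<rho> u"
  by (auto simp: truncation_def \<rho>_nonneg split: split_indicator)

lemma truncation_even: "truncation n (- u) = truncation n u"
  by (simp add: truncation_def even indicator_def)

text \<open>Capping the height at \<open>n\<close> tames the singularity and cutting to a ball makes
  the support of finite volume.\<close>

lemma truncation_finite: "(\<integral>\<^sup>+u. ennreal (truncation n u) \<partial>lborel) < \<infinity>"
proof -
  have "(\<integral>\<^sup>+u. ennreal (truncation n u) \<partial>lborel)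
      \<le> (\<integral>\<^sup>+u. ennreal (real n) * indicator (cball (0::'a) (real n)) u \<partial>lborel)"
    by (intro nn_integral_mono) (auto simp: truncation_def split: split_indicator)
  also have "\<dots> < \<infinity>"
    by (simp add: nn_integral_cmult_indicator ennreal_mult_less_top emeasure_bounded_finite[OF bounded_cball, simplified])
  finally show ?thesis .
qed

lemma truncation_tendsto: "(\<lambda>n. truncation n u) \<longlonglongrightarrow> \<rho> u"
proof (rule tendsto_eventually)
  obtain N where N: "max (\<rho> u) (norm u) \<le> real N"
    using real_arch_simple by blast
  have "truncation n u = \<rho> u" if "N \<le> n" for n
    using that N by (auto simp: truncation_def indicator_def)
  then show "\<forall>\<^sub>F n in sequentially. truncation n u = \<rho> u"
    by (auto simp: eventually_sequentially)
qed

text \<open>Dominated convergence with the untruncated integrand as majorant.\<close>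

lemma levy_exp_remainder_tendsto: "(\<lambda>n. levy_exp (\<lambda>u. \<rho> u - truncation n u) \<xi>) \<longlonglongrightarrow> 0"
proof -
  have "(\<lambda>n. levy_exp (\<lambda>u. \<rho> u - truncation n u) \<xi>) \<longlonglongrightarrow> integral\<^sup>L lborel (\<lambda>u::'a. 0)"
    unfolding levy_exp_def
  proof (rule integral_dominated_convergence)
    show "integrable lborel (\<lambda>u. (1 - cos (\<xi> \<bullet> u)) * \<rho> u)"
      using weight by (simp add: levy_weight_def)
    have "(\<lambda>n. (1 - cos (\<xi> \<bullet> u)) * (\<rho> u - truncation n u)) \<longlonglongrightarrow> (1 - cos (\<xi> \<bullet> u)) * (\<rho> u - \<rho> u)" for u
      by (intro tendsto_intros truncation_tendsto)
    then show "AE u in lborel. (\<lambda>n. (1 - cos (\<xi> \<bullet> u)) * (\<rho> u - truncation n u)) \<longlonglongrightarrow> 0"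
      by simp
    show "AE u in lborel. norm ((1 - cos (\<xi> \<bullet> u)) * (\<rho> u - truncation n u)) \<le> (1 - cos (\<xi> \<bullet> u)) * \<rho> u" for n
      using truncation_nonneg[of n] truncation_le[of n]
      by (auto simp: abs_mult intro!: mult_left_mono)
  qed measurable
  then show ?thesis by simp
qed

text \<open>Every entry involves three exponents of the remainder, all tending to \<open>0\<close>,
  so \<open>exp\<close> minus \<open>1\<close> tends to \<open>0\<close>. Frequencies and
  coefficients are fixed throughout; the convergence is not uniform in them.\<close>

lemma remainder_kernel_tendsto: "(\<lambda>n. quad_form (remainder_kernel (truncation n)) J c) \<longlonglongrightarrow> 0"
proof -
  have "(\<lambda>n. quad_form (remainder_kernel (truncation n)) J c)
    \<longlonglongrightarrow> (\<Sum>j\<in>J. \<Sum>k\<in>J. Re (c j * cnj (c k)) * (\<phi> j * \<phi> k * (exp (0 + 0 - 0) - 1)))"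
    unfolding quad_form_def
      remainder_kernel_def[OF truncation_measurable truncation_nonneg truncation_le] levy_kernel_def
    by (intro tendsto_intros levy_exp_remainder_tendsto)
  then show ?thesis by simp
qed

lemma jump_energy_le:
  assumes [measurable]: "h \<in> borel_measurable borel" "g \<in> borel_measurable borel"
    "g' \<in> borel_measurable borel" "g'' \<in> borel_measurable borel"
    and nn: "\<And>u. 0 \<le> h u" and ab: "0 \<le> a" "0 \<le> b"
    and le: "\<And>x u. (norm (g (x + u) - g x))\<^sup>2
      \<le> a * (norm (g' (x + u) - g' x))\<^sup>2 + b * (norm (g'' (x + u) - g'' x))\<^sup>2"
  shows "jump_energy \<mu> h g \<le> ennreal a * jump_energy \<mu> h g' + ennreal b * jump_energy \<mu> h g''"
proof -
  have "jump_energy \<mu> h g \<le> (\<integral>\<^sup>+x. (\<integral>\<^sup>+u. ennreal a * ennreal ((norm (g' (x + u) - g' x))\<^sup>2 * h u)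
      + ennreal b * ennreal ((norm (g'' (x + u) - g'' x))\<^sup>2 * h u) \<partial>lborel) \<partial>\<mu>)"
    unfolding jump_energy_def
  proof (intro nn_integral_mono)
    fix x u
    show "ennreal ((norm (g (x + u) - g x))\<^sup>2 * h u)
        \<le> ennreal a * ennreal ((norm (g' (x + u) - g' x))\<^sup>2 * h u)
          + ennreal b * ennreal ((norm (g'' (x + u) - g'' x))\<^sup>2 * h u)"
      using mult_right_mono[OF le[of x u] nn[of u]] nn[of u] ab
      by (simp add: algebra_simps flip: ennreal_mult ennreal_plus)
  qed
  also have "\<dots> = ennreal a * jump_energy \<mu> h g' + ennreal b * jump_energy \<mu> h g''"
    unfolding jump_energy_def
    by (subst nn_integral_cmult[symmetric], measurable)+
      (simp add: nn_integral_add nn_integral_cmult)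
  finally show ?thesis .
qed

text \<open>
  Both error terms are controlled by one finite measure: the sum of \<open>\<mu>\<close>, weighted by the mass of
  \<open>h\<close>, and of the law of \<open>X + u\<close> under \<open>\<mu> \<otimes> h du\<close>.
\<close>

lemma joint_trig_approx:
  fixes f :: "'a \<Rightarrow> real"
  assumes f [measurable]: "f \<in> borel_measurable borel" and L2: "(\<integral>\<^sup>+x. ennreal ((f x)\<^sup>2) \<partial>\<mu>) < \<infinity>"
    and h [measurable]: "h \<in> borel_measurable borel" and nn: "\<And>u. 0 \<le> h u"
    and h_finite: "(\<integral>\<^sup>+u. ennreal (h u) \<partial>lborel) < \<infinity>"
    and energy: "jump_energy \<mu> h (\<lambda>x. of_real (f x)) < \<infinity>" and e: "0 < e"
  obtains T where "trig_poly T" "(\<integral>\<^sup>+x. ennreal ((norm (of_real (f x) - T x))\<^sup>2) \<partial>\<mu>) < ennreal e"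
    "jump_energy \<mu> h (\<lambda>x. of_real (f x) - T x) < ennreal e"
proof -
  define N where "N = density lborel (\<lambda>u. ennreal (h u))"
  have sets_N [measurable_cong]: "sets N = sets borel"
    by (simp add: N_def)
  define w where "w = (\<integral>\<^sup>+u. ennreal (h u) \<partial>lborel)"
  have w_finite: "w < \<infinity>"
    using h_finite by (simp add: w_def)
  have w: "emeasure N (space N) = w"
    by (simp add: N_def w_def emeasure_density space_density)
  interpret N: finite_measure N
    by standard (use w_finite w in auto)
  have N_int: "(\<integral>\<^sup>+u. g u \<partial>N) = (\<integral>\<^sup>+u. g u * ennreal (h u) \<partial>lborel)" if "g \<in> borel_measurable borel" for g
    unfolding N_def using that by (simp add: nn_integral_density mult.commute)
  let ?P = "\<mu> \<Otimes>\<^sub>M N"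
  interpret P: pair_sigma_finite \<mu> N ..
  interpret PP: finite_measure ?P
    by (rule finite_measure_pair_measure) unfold_locales
  \<comment> \<open>The boolean selects between \<open>x + u\<close> and \<open>x\<close>, which
    adds two laws inside a single push-forward. In the second case integrating out \<open>u\<close>
    leaves the factor \<open>w\<close>, the mass of \<open>h\<close>.\<close>
  define \<kappa> where "\<kappa> = distr (count_space (UNIV :: bool set) \<Otimes>\<^sub>M ?P) borel (\<lambda>(b, x, u). if b then x + u else x)"
  have \<kappa>_int: "(\<integral>\<^sup>+x. g x \<partial>\<kappa>) = (\<integral>\<^sup>+x. (\<integral>\<^sup>+u. g (x + u) * ennreal (h u) \<partial>lborel) \<partial>\<mu>) + w * (\<integral>\<^sup>+x. g x \<partial>\<mu>)"
    if [measurable]: "g \<in> borel_measurable borel" for g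
  proof -
    have "(\<integral>\<^sup>+x. g x \<partial>\<kappa>) = (\<integral>\<^sup>+p. g (case p of (b, x, u) \<Rightarrow> if b then x + u else x) \<partial>(count_space UNIV \<Otimes>\<^sub>M ?P))"
      unfolding \<kappa>_def by (rule nn_integral_distr) measurable
    also have "\<dots> = (\<integral>\<^sup>+b. (\<integral>\<^sup>+p. g (case p of (x, u) \<Rightarrow> if b then x + u else x) \<partial>?P) \<partial>count_space UNIV)"
      by (subst P.nn_integral_fst[symmetric]) (auto simp: case_prod_unfold cong: if_cong)
    also have "\<dots> = (\<integral>\<^sup>+p. g (fst p + snd p) \<partial>?P) + (\<integral>\<^sup>+p. g (fst p) \<partial>?P)"
      by (simp add: nn_integral_count_space_finite UNIV_bool case_prod_unfold add.commute)
    also have "(\<integral>\<^sup>+p. g (fst p + snd p) \<partial>?P) = (\<integral>\<^sup>+x. (\<integral>\<^sup>+u. g (x + u) * ennreal (h u) \<partial>lborel) \<partial>\<mu>)"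
      by (subst N.nn_integral_fst[symmetric]) (auto simp: N_int)
    also have "(\<integral>\<^sup>+p. g (fst p) \<partial>?P) = w * (\<integral>\<^sup>+x. g x \<partial>\<mu>)"
      by (subst N.nn_integral_fst[symmetric]) (auto simp: w nn_integral_cmult nn_integral_multc mult.commute)
    finally show ?thesis .
  qed
  have \<kappa>: "sets \<kappa> = sets borel" "finite_measure \<kappa>"
  proof -
    show "sets \<kappa> = sets borel" by (simp add: \<kappa>_def)
    have "emeasure \<kappa> (space \<kappa>) = (\<integral>\<^sup>+x. 1 \<partial>\<kappa>)" by simp
    also have "\<dots> = w + w"
      by (subst \<kappa>_int) (simp_all add: w_def emeasure_space_1)
    finally show "finite_measure \<kappa>"
      using w_finite by (intro finite_measureI) simp
  qed
  have bound: "(norm (a - b))\<^sup>2 * c \<le> 2 * ((norm a)\<^sup>2 * c) + 2 * ((norm b)\<^sup>2 * c)"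
    if "0 \<le> c" for a b :: complex and c :: real
    using mult_right_mono[OF norm_diff_square_le[of a b 0] that] by (simp add: algebra_simps)
  have energy_le: "jump_energy \<mu> h g \<le> 2 * (\<integral>\<^sup>+x. ennreal ((norm (g x))\<^sup>2) \<partial>\<kappa>)"
    if [measurable]: "g \<in> borel_measurable borel" for g
  proof -
    have "jump_energy \<mu> h g \<le> (\<integral>\<^sup>+x. (\<integral>\<^sup>+u. 2 * (ennreal ((norm (g (x + u)))\<^sup>2) * ennreal (h u))
        + 2 * (ennreal ((norm (g x))\<^sup>2) * ennreal (h u)) \<partial>lborel) \<partial>\<mu>)"
      unfolding jump_energy_def
    proof (intro nn_integral_mono)
      fix x u
      show "ennreal ((norm (g (x + u) - g x))\<^sup>2 * h u)
          \<le> 2 * (ennreal ((norm (g (x + u)))\<^sup>2) * ennreal (h u)) + 2 * (ennreal ((norm (g x))\<^sup>2) * ennreal (h u))"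
        using bound[OF nn[of u], of "g (x + u)" "g x"] nn[of u]
        by (simp flip: ennreal_mult ennreal_plus ennreal_numeral)
    qed
    also have "\<dots> = 2 * (\<integral>\<^sup>+x. (\<integral>\<^sup>+u. ennreal ((norm (g (x + u)))\<^sup>2) * ennreal (h u) \<partial>lborel) \<partial>\<mu>)
        + 2 * (w * (\<integral>\<^sup>+x. ennreal ((norm (g x))\<^sup>2) \<partial>\<mu>))"
      by (simp add: nn_integral_add nn_integral_cmult w_def[symmetric] nn_integral_multc mult.commute)
    finally show ?thesis
      by (simp add: \<kappa>_int distrib_left)
  qed
  \<comment> \<open>Finite energy enters here: it makes \<open>f\<close> square integrable under the
    law of \<open>X + u\<close>, which need not be controlled by \<open>\<mu>\<close> alone.\<close>
  have shift_le: "(\<integral>\<^sup>+x. (\<integral>\<^sup>+u. ennreal ((f (x + u))\<^sup>2) * ennreal (h u) \<partial>lborel) \<partial>\<mu>)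
      \<le> 2 * jump_energy \<mu> h (\<lambda>x. of_real (f x)) + 2 * (w * (\<integral>\<^sup>+x. ennreal ((f x)\<^sup>2) \<partial>\<mu>))"
  proof -
    have "(\<integral>\<^sup>+x. (\<integral>\<^sup>+u. ennreal ((f (x + u))\<^sup>2) * ennreal (h u) \<partial>lborel) \<partial>\<mu>)
        \<le> (\<integral>\<^sup>+x. (\<integral>\<^sup>+u. 2 * ennreal ((norm (complex_of_real (f (x + u)) - of_real (f x)))\<^sup>2 * h u)
          + 2 * (ennreal ((f x)\<^sup>2) * ennreal (h u)) \<partial>lborel) \<partial>\<mu>)"
    proof (intro nn_integral_mono)
      fix x u
      show "ennreal ((f (x + u))\<^sup>2) * ennreal (h u)
          \<le> 2 * ennreal ((norm (complex_of_real (f (x + u)) - of_real (f x)))\<^sup>2 * h u)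
            + 2 * (ennreal ((f x)\<^sup>2) * ennreal (h u))"
        using bound[OF nn[of u], of "complex_of_real (f (x + u)) - of_real (f x)" "- of_real (f x)"] nn[of u]
        by (simp flip: ennreal_mult ennreal_plus ennreal_numeral)
    qed
    also have "\<dots> = 2 * jump_energy \<mu> h (\<lambda>x. of_real (f x)) + 2 * (w * (\<integral>\<^sup>+x. ennreal ((f x)\<^sup>2) \<partial>\<mu>))"
      unfolding jump_energy_def
      by (simp add: nn_integral_add nn_integral_cmult w_def[symmetric] nn_integral_multc mult.commute)
    finally show ?thesis .
  qed
  show thesis
  proof (cases "w = 0")
    case True
    \<comment> \<open>Here \<open>\<kappa>\<close> is the zero measure and says nothing about
      \<open>\<mu>\<close>; but every energy for \<open>h\<close> vanishes, so approximation in L2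
      of \<open>\<mu>\<close> is enough.\<close>
    have "AE u in lborel. ennreal (h u) = 0"
      using True unfolding w_def by (subst (asm) nn_integral_0_iff_AE) auto
    then have "AE u in lborel. ennreal ((norm (g (x + u) - g x))\<^sup>2 * h u) = 0" for g :: "'a \<Rightarrow> complex" and x
      by eventually_elim (use nn in \<open>auto simp: ennreal_eq_0_iff mult_nonneg_nonpos\<close>)
    then have zero: "jump_energy \<mu> h g = 0" if [measurable]: "g \<in> borel_measurable borel" for g
      unfolding jump_energy_def by (subst nn_integral_cong_AE[where v = "\<lambda>_. 0" and M = lborel]) auto
    obtain T where T: "trig_poly T" "(\<integral>\<^sup>+x. ennreal ((norm (of_real (f x) - T x))\<^sup>2) \<partial>\<mu>) < ennreal e"
      using trig_poly_dense_L2[OF sets_eq finite_measure_axioms f L2] e unfolding trig_approximable_def by blast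
    note [measurable] = measurable_trig_poly[OF T(1)]
    show thesis
      by (rule that[OF T]) (simp add: zero e)
  next
    case False
    define r where "r = enn2real w"
    have r: "w = ennreal r" "0 < r"
      using False w_finite by (auto simp: r_def less_top enn2real_positive_iff zero_less_iff_neq_zero)
    \<comment> \<open>The bound \<open>e / 2\<close> compensates the factor \<open>2\<close> in
      \<open>energy_le\<close>; the bound \<open>e * r\<close> compensates the weight
      \<open>w = r\<close> that \<open>\<mu>\<close> carries inside \<open>\<kappa>\<close>.\<close>
    define d where "d = min (e / 2) (e * r)"
    have d: "0 < d" "d \<le> e / 2" "d \<le> e * r"
      using e r by (auto simp: d_def)
    have "(\<integral>\<^sup>+x. ennreal ((f x)\<^sup>2) \<partial>\<kappa>) < \<infinity>"
      using shift_le energy L2 w_finite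
      by (simp add: \<kappa>_int ennreal_mult_less_top le_less_trans)
    from trig_poly_dense_L2[OF \<kappa> f this]
    obtain T where T: "trig_poly T" "(\<integral>\<^sup>+x. ennreal ((norm (of_real (f x) - T x))\<^sup>2) \<partial>\<kappa>) < ennreal d"
      using d(1) unfolding trig_approximable_def by blast
    note [measurable] = measurable_trig_poly[OF T(1)]
    let ?g = "\<lambda>x. of_real (f x) - T x"
    show thesis
    proof (rule that[OF T(1)])
      have "jump_energy \<mu> h ?g \<le> 2 * (\<integral>\<^sup>+x. ennreal ((norm (?g x))\<^sup>2) \<partial>\<kappa>)"
        by (rule energy_le) measurable
      also have "\<dots> < 2 * ennreal d"
        using T(2) by (intro ennreal_mult_strict_left_mono) auto
      also have "\<dots> \<le> ennreal e"
        using d by (simp flip: ennreal_mult' ennreal_numeral)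
      finally show "jump_energy \<mu> h ?g < ennreal e" .
      have "w * (\<integral>\<^sup>+x. ennreal ((norm (?g x))\<^sup>2) \<partial>\<mu>) \<le> (\<integral>\<^sup>+x. ennreal ((norm (?g x))\<^sup>2) \<partial>\<kappa>)"
        by (subst \<kappa>_int) auto
      also have "\<dots> < ennreal d"
        by (rule T)
      also have "\<dots> \<le> w * ennreal e"
        using d r e by (simp add: mult.commute flip: ennreal_mult)
      finally show "(\<integral>\<^sup>+x. ennreal ((norm (?g x))\<^sup>2) \<partial>\<mu>) < ennreal e"
        by (meson mult_left_mono not_le zero_le)
    qed
  qed
qed

text \<open>The kernel inequality holds for a polynomial \<open>T\<close> near \<open>f\<close>;
  passing between \<open>T\<close> and \<open>f\<close> costs factors \<open>1 + \<eta>\<close> and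
  errors proportional to \<open>e\<close>. The errors carry the weight
  \<open>1 + 1 / \<eta>\<close>, so \<open>e\<close> is sent to \<open>0\<close> with
  \<open>\<eta>\<close> fixed, and \<open>\<eta>\<close> only afterwards.\<close>

lemma poincare_centered:
  fixes f :: "'a \<Rightarrow> real"
  assumes f [measurable]: "f \<in> borel_measurable borel" and int: "integrable \<mu> (\<lambda>x. (f x)\<^sup>2)"
    and mean: "(\<integral>x. f x \<partial>\<mu>) = 0"
    and E: "jump_energy \<mu> \<rho> (\<lambda>x. of_real (f x)) = ennreal E" "0 \<le> E"
  shows "(\<integral>x. (f x)\<^sup>2 \<partial>\<mu>) \<le> E"
proof -
  define V where "V = (\<integral>x. (f x)\<^sup>2 \<partial>\<mu>)"
  have V: "(\<integral>\<^sup>+x. ennreal ((f x)\<^sup>2) \<partial>\<mu>) = ennreal V"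
    unfolding V_def by (rule nn_integral_eq_integral[OF int]) simp
  have int_f: "integrable \<mu> f"
    by (rule square_integrable_imp_integrable[OF _ int]) measurable
  let ?f = "\<lambda>x. complex_of_real (f x)"
  let ?L2 = "\<lambda>g. \<integral>\<^sup>+x. ennreal ((norm (g x))\<^sup>2) \<partial>\<mu>"
  have approx: "V \<le> (1 + \<eta>) * (((1 + \<eta>) * E + (1 + 1 / \<eta>) * e) + 10 * e) + (1 + 1 / \<eta>) * e"
    if \<eta>: "0 < \<eta>" and e: "0 < e" for \<eta> e
  proof -
    have L2_finite: "(\<integral>\<^sup>+x. ennreal ((f x)\<^sup>2) \<partial>\<mu>) < \<infinity>"
      by (simp add: V)
    \<comment> \<open>Chosen before the truncation level \<open>n\<close>, which then depends on
      \<open>T0\<close>.\<close>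
    obtain T0 where T0: "trig_poly T0" "?L2 (\<lambda>x. ?f x - T0 x) < ennreal e"
      using trig_poly_dense_L2[OF sets_eq finite_measure_axioms f L2_finite] e
      unfolding trig_approximable_def by blast
    then obtain J0 c0 where J0: "finite J0" "T0 = trig_sum J0 c0"
      by (auto simp: trig_poly_def)
    obtain n where n: "quad_form (remainder_kernel (truncation n)) J0 c0 < e"
      using order_tendstoD(2)[OF remainder_kernel_tendsto, of e J0 c0] e
      by (auto dest: eventually_happens)
    let ?h = "truncation n"
    note h = truncation_measurable[of n] truncation_nonneg[of n] truncation_le[of n]
    have "jump_energy \<mu> ?h ?f \<le> jump_energy \<mu> \<rho> ?f"
      unfolding jump_energy_def
      by (intro nn_integral_mono ennreal_leI mult_left_mono truncation_le) simp
    then have E_h: "jump_energy \<mu> ?h ?f \<le> ennreal E"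
      by (simp add: E)
    then have "jump_energy \<mu> ?h ?f < \<infinity>"
      by (rule le_less_trans) simp
    \<comment> \<open>The second polynomial depends on \<open>n\<close>, since its closeness in
      energy refers to the density \<open>truncation n\<close>.\<close>
    from joint_trig_approx[OF f L2_finite h(1,2) truncation_finite this e]
    obtain T where T: "trig_poly T" "?L2 (\<lambda>x. ?f x - T x) < ennreal e"
      "jump_energy \<mu> ?h (\<lambda>x. ?f x - T x) < ennreal e"
      by blast
    then obtain J1 c1 where J1: "finite J1" "T = trig_sum J1 c1"
      by (auto simp: trig_poly_def)
    note [measurable] = measurable_trig_poly[OF T(1)] measurable_trig_poly[OF T0(1)]
    define J where "J = J0 \<union> J1"
    define c where "c j = (if j \<in> J1 then c1 j else 0)" for j
    define d where "d j = (if j \<in> J0 then c0 j else 0)" for j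
    have J: "finite J" and T_eq: "T = trig_sum J c" and T0_eq: "T0 = trig_sum J d"
      using J0 J1 unfolding J_def c_def[abs_def] d_def[abs_def]
      by (auto intro: trig_sum_extend)
    let ?R = "remainder_kernel ?h"
    have R_d: "quad_form ?R J d = quad_form ?R J0 c0"
      unfolding quad_form_def using J0(1) J1(1)
      by (intro sum.mono_neutral_cong_right) (auto simp: J_def d_def intro!: sum.mono_neutral_cong_right)
    \<comment> \<open>Both polynomials are close to \<open>f\<close> in L2, hence close to each
      other, and the remainder form lies below the L2 form.\<close>
    have R_diff: "ennreal (quad_form ?R J (\<lambda>j. c j - d j)) \<le> 4 * ennreal e"
    proof -
      have "quad_form ?R J (\<lambda>j. c j - d j) \<le> quad_form (\<lambda>j k. \<phi> (j - k)) J (\<lambda>j. c j - d j)"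
        by (rule quad_form_mono[OF psd_remainder_kernel_le[OF h] J])
      then have "ennreal (quad_form ?R J (\<lambda>j. c j - d j)) \<le> ?L2 (trig_sum J (\<lambda>j. c j - d j))"
        unfolding trig_sum_nn_L2 by (rule ennreal_leI)
      also have "trig_sum J (\<lambda>j. c j - d j) = (\<lambda>x. T x - T0 x)"
        by (simp add: T_eq T0_eq trig_sum_def fun_eq_iff left_diff_distrib sum_subtractf)
      also have "?L2 (\<lambda>x. T x - T0 x)
          \<le> (\<integral>\<^sup>+x. 2 * ennreal ((norm (?f x - T x))\<^sup>2) + 2 * ennreal ((norm (?f x - T0 x))\<^sup>2) \<partial>\<mu>)"
      proof (intro nn_integral_mono)
        fix x
        show "ennreal ((norm (T x - T0 x))\<^sup>2)
            \<le> 2 * ennreal ((norm (?f x - T x))\<^sup>2) + 2 * ennreal ((norm (?f x - T0 x))\<^sup>2)"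
          using norm_diff_square_le[of "T x" "T0 x" "?f x"]
          by (simp add: norm_minus_commute flip: ennreal_mult ennreal_plus ennreal_numeral)
      qed
      also have "\<dots> = 2 * ?L2 (\<lambda>x. ?f x - T x) + 2 * ?L2 (\<lambda>x. ?f x - T0 x)"
        by (simp add: nn_integral_add nn_integral_cmult)
      also have "\<dots> \<le> 2 * ennreal e + 2 * ennreal e"
        using T(2) T0(2) by (intro add_mono mult_left_mono) auto
      also have "\<dots> = 4 * ennreal e"
        by (simp flip: distrib_right)
      finally show ?thesis .
    qed
    then have "quad_form ?R J (\<lambda>j. c j - d j) \<le> 4 * e"
      using e by (simp flip: ennreal_mult ennreal_numeral)
    \<comment> \<open>The constant is \<open>10 = 2 * 1 + 2 * 4\<close>: the form at
      \<open>T0\<close> is below \<open>e\<close> and the one at \<open>T - T0\<close> is at most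
      \<open>4 * e\<close>.\<close>
    then have R: "quad_form ?R J c \<le> 10 * e"
      using quad_form_triangle[OF psd_remainder_kernel[OF h] J, of c d] n unfolding R_d by simp
    have "jump_energy \<mu> ?h T \<le> ennreal (1 + \<eta>) * jump_energy \<mu> ?h ?f
        + ennreal (1 + 1 / \<eta>) * jump_energy \<mu> ?h (\<lambda>x. ?f x - T x)"
    proof (rule jump_energy_le)
      fix x u
      show "(norm (T (x + u) - T x))\<^sup>2 \<le> (1 + \<eta>) * (norm (?f (x + u) - ?f x))\<^sup>2
          + (1 + 1 / \<eta>) * (norm (?f (x + u) - T (x + u) - (?f x - T x)))\<^sup>2"
        using norm_diff_square_le_weighted[OF \<eta>, of 0 "T (x + u) - T x" "?f (x + u) - ?f x"]
        by (simp add: norm_minus_commute algebra_simps)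
    qed (use \<eta> truncation_nonneg in auto)
    also have "\<dots> \<le> ennreal (1 + \<eta>) * ennreal E + ennreal (1 + 1 / \<eta>) * ennreal e"
      using E_h T(3) by (intro add_mono mult_left_mono) auto
    also have "\<dots> = ennreal ((1 + \<eta>) * E + (1 + 1 / \<eta>) * e)"
      using \<eta> e E(2) by (simp flip: ennreal_mult ennreal_plus)
    finally have energy_T: "quad_form (\<lambda>j k. \<phi> (j - k) * levy_kernel ?h j k) J c \<le> (1 + \<eta>) * E + (1 + 1 / \<eta>) * e"
      unfolding T_eq jump_energy_trig_sum[OF weight_below[OF h] truncation_even]
      using \<eta> e E(2) by (subst (asm) ennreal_le_iff) auto
    define m where "m = (\<Sum>j\<in>J. c j * \<phi> j)"
    have var_T: "?L2 (\<lambda>x. T x - m) \<le> ennreal ((1 + \<eta>) * E + (1 + 1 / \<eta>) * e + 10 * e)"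
      unfolding T_eq m_def trig_sum_variance
      using quad_form_variance_le[OF h J, of c] energy_T R by (intro ennreal_leI) linarith
    \<comment> \<open>The mean \<open>m\<close> of \<open>T\<close> need not vanish. As
      \<open>f\<close> has mean \<open>0\<close>, subtracting the constant \<open>m\<close> from
      \<open>f\<close> only adds its squared modulus to \<open>V\<close>.\<close>
    have expand: "(norm (?f x - m))\<^sup>2 = (f x)\<^sup>2 - 2 * Re m * f x + (norm m)\<^sup>2" for x
      unfolding cmod_power2 by (simp add: power2_eq_square algebra_simps)
    have "integrable \<mu> (\<lambda>x. (norm (?f x - m))\<^sup>2)"
      unfolding expand using int int_f by simp
    then have "?L2 (\<lambda>x. ?f x - m) = ennreal (\<integral>x. (norm (?f x - m))\<^sup>2 \<partial>\<mu>)"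
      by (rule nn_integral_eq_integral) simp
    also have "(\<integral>x. (norm (?f x - m))\<^sup>2 \<partial>\<mu>) = V + (norm m)\<^sup>2"
      unfolding expand using int int_f by (simp add: V_def mean prob_space)
    finally have "ennreal V \<le> ?L2 (\<lambda>x. ?f x - m)"
      by (simp add: ennreal_leI)
    also have "\<dots> \<le> (\<integral>\<^sup>+x. ennreal (1 + \<eta>) * ennreal ((norm (T x - m))\<^sup>2)
        + ennreal (1 + 1 / \<eta>) * ennreal ((norm (?f x - T x))\<^sup>2) \<partial>\<mu>)"
    proof (intro nn_integral_mono)
      fix x
      show "ennreal ((norm (?f x - m))\<^sup>2) \<le> ennreal (1 + \<eta>) * ennreal ((norm (T x - m))\<^sup>2)
          + ennreal (1 + 1 / \<eta>) * ennreal ((norm (?f x - T x))\<^sup>2)"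
        using norm_diff_square_le_weighted[OF \<eta>, of m "?f x" "T x"] \<eta>
        by (simp add: norm_minus_commute flip: ennreal_mult ennreal_plus)
    qed
    also have "\<dots> = ennreal (1 + \<eta>) * ?L2 (\<lambda>x. T x - m) + ennreal (1 + 1 / \<eta>) * ?L2 (\<lambda>x. ?f x - T x)"
      by (simp add: nn_integral_add nn_integral_cmult)
    also have "\<dots> \<le> ennreal (1 + \<eta>) * ennreal ((1 + \<eta>) * E + (1 + 1 / \<eta>) * e + 10 * e)
        + ennreal (1 + 1 / \<eta>) * ennreal e"
      using var_T T(2) by (intro add_mono mult_left_mono) auto
    also have "\<dots> = ennreal ((1 + \<eta>) * (((1 + \<eta>) * E + (1 + 1 / \<eta>) * e) + 10 * e) + (1 + 1 / \<eta>) * e)"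
      using \<eta> e E(2) by (simp flip: ennreal_mult ennreal_plus)
    finally show ?thesis
      using \<eta> e E(2) by (subst (asm) ennreal_le_iff) auto
  qed
  have approx': "V \<le> (1 + \<eta>) * ((1 + \<eta>) * E)" if "0 < \<eta>" for \<eta>
  proof (rule tendsto_lowerbound)
    have "((\<lambda>e. (1 + \<eta>) * (((1 + \<eta>) * E + (1 + 1 / \<eta>) * e) + 10 * e) + (1 + 1 / \<eta>) * e)
        \<longlongrightarrow> (1 + \<eta>) * (((1 + \<eta>) * E + (1 + 1 / \<eta>) * 0) + 10 * 0) + (1 + 1 / \<eta>) * 0) (at_right 0)"
      by (intro tendsto_intros)
    then show "((\<lambda>e. (1 + \<eta>) * (((1 + \<eta>) * E + (1 + 1 / \<eta>) * e) + 10 * e) + (1 + 1 / \<eta>) * e)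
        \<longlongrightarrow> (1 + \<eta>) * ((1 + \<eta>) * E)) (at_right 0)"
      by simp
  qed (auto simp: eventually_at_right_less intro!: eventually_mono[OF eventually_at_right_less] approx that)
  show ?thesis
    unfolding V_def[symmetric]
  proof (rule tendsto_lowerbound)
    have "((\<lambda>\<eta>. (1 + \<eta>) * ((1 + \<eta>) * E)) \<longlongrightarrow> (1 + 0) * ((1 + 0) * E)) (at_right 0)"
      by (intro tendsto_intros)
    then show "((\<lambda>\<eta>. (1 + \<eta>) * ((1 + \<eta>) * E)) \<longlongrightarrow> E) (at_right 0)"
      by simp
  qed (auto intro!: eventually_mono[OF eventually_at_right_less] approx')
qed

text \<open>Subtracting the mean changes neither variance nor energy, and infinite energy makes the
  claim trivial, which leaves the centred case.\<close>

theorem poincare: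
  fixes f :: "'a \<Rightarrow> real"
  assumes f [measurable]: "f \<in> borel_measurable borel" and fin: "finite_variance \<mu> f"
  shows "ennreal (variance f) \<le> jump_energy \<mu> \<rho> (\<lambda>x. of_real (f x))"
proof (cases "jump_energy \<mu> \<rho> (\<lambda>x. of_real (f x))")
  case (real E)
  define g where "g x = f x - expectation f" for x
  have "(\<integral>x. (g x)\<^sup>2 \<partial>\<mu>) \<le> E"
  proof (rule poincare_centered)
    show "g \<in> borel_measurable borel" unfolding g_def by measurable
    show "integrable \<mu> (\<lambda>x. (g x)\<^sup>2)"
      using fin by (simp add: finite_variance_def g_def)
    show "(\<integral>x. g x \<partial>\<mu>) = 0"
      using fin by (simp add: finite_variance_def g_def prob_space)
    show "jump_energy \<mu> \<rho> (\<lambda>x. of_real (g x)) = ennreal E"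
      using real by (simp add: jump_energy_def g_def)
  qed (use real in simp)
  with real show ?thesis
    by (simp add: g_def ennreal_leI)
qed simp

text \<open>Cosine and sine are the two parts of one character and squared moduli add. For a single
  frequency the form is \<open>\<phi> 0 * levy_kernel \<rho> \<xi> \<xi>\<close> with
  \<open>\<phi> 0 = 1\<close>. Taking the pair gives real test functions without computing either
  energy separately.\<close>

lemma iexp_energy:
  "jump_energy \<mu> \<rho> (\<lambda>x. of_real (cos (\<xi> \<bullet> x))) + jump_energy \<mu> \<rho> (\<lambda>x. of_real (sin (\<xi> \<bullet> x)))
    = ennreal (2 * levy_exp \<rho> \<xi>)"
proof -
  let ?c = "\<lambda>x. complex_of_real (cos (\<xi> \<bullet> x))" and ?s = "\<lambda>x. complex_of_real (sin (\<xi> \<bullet> x))"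
  have split: "ennreal ((norm (iexp (\<xi> \<bullet> (x + u)) - iexp (\<xi> \<bullet> x)))\<^sup>2 * \<rho> u)
      = ennreal ((norm (?c (x + u) - ?c x))\<^sup>2 * \<rho> u) + ennreal ((norm (?s (x + u) - ?s x))\<^sup>2 * \<rho> u)" for x u
  proof -
    have "(norm (iexp (\<xi> \<bullet> (x + u)) - iexp (\<xi> \<bullet> x)))\<^sup>2 = (norm (?c (x + u) - ?c x))\<^sup>2 + (norm (?s (x + u) - ?s x))\<^sup>2"
      unfolding cmod_power2 by (simp add: Re_exp Im_exp)
    then show ?thesis
      by (simp add: distrib_right \<rho>_nonneg del: norm_of_real)
  qed
  have "jump_energy \<mu> \<rho> (trig_sum {\<xi>} (\<lambda>_. 1)) = jump_energy \<mu> \<rho> ?c + jump_energy \<mu> \<rho> ?s"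
    unfolding jump_energy_def trig_sum_def
    by (simp add: split nn_integral_add del: norm_of_real)
  moreover have "quad_form (\<lambda>j k. \<phi> (j - k) * levy_kernel \<rho> j k) {\<xi>} (\<lambda>_. 1) = 2 * levy_exp \<rho> \<xi>"
    by (simp add: quad_form_def \<phi>_def levy_kernel_def)
  ultimately show ?thesis
    using jump_energy_trig_sum[OF weight even, of "{\<xi>}" "\<lambda>_. 1"] by simp
qed

text \<open>The squares add up to \<open>1\<close>; the characteristic function is real, so the sine
  is centred and only the square of \<open>\<phi> \<xi>\<close> is subtracted.\<close>

lemma iexp_variance:
  "variance (\<lambda>x. cos (\<xi> \<bullet> x)) + variance (\<lambda>x. sin (\<xi> \<bullet> x)) = 1 - exp (- (2 * levy_exp \<rho> \<xi>))"
proof -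
  have cos: "(\<integral>x. cos (\<xi> \<bullet> x) \<partial>\<mu>) = \<phi> \<xi>"
    using integral_Re[OF iexp_integral(1), of \<xi>] by (simp add: iexp_integral Re_exp)
  have sin: "(\<integral>x. sin (\<xi> \<bullet> x) \<partial>\<mu>) = 0"
    using integral_Im[OF iexp_integral(1), of \<xi>] by (simp add: iexp_integral Im_exp)
  have i: "integrable \<mu> (\<lambda>x. cos (\<xi> \<bullet> x))" "integrable \<mu> (\<lambda>x. sin (\<xi> \<bullet> x))"
    "integrable \<mu> (\<lambda>x. (cos (\<xi> \<bullet> x))\<^sup>2)" "integrable \<mu> (\<lambda>x. (sin (\<xi> \<bullet> x))\<^sup>2)"
    by (auto intro!: integrable_const_bound[of _ 1] simp: abs_square_le_1)
  have "(\<integral>x. (cos (\<xi> \<bullet> x))\<^sup>2 \<partial>\<mu>) + (\<integral>x. (sin (\<xi> \<bullet> x))\<^sup>2 \<partial>\<mu>) = (\<integral>x. (cos (\<xi> \<bullet> x))\<^sup>2 + (sin (\<xi> \<bullet> x))\<^sup>2 \<partial>\<mu>)"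
    by (rule Bochner_Integration.integral_add[OF i(3,4), symmetric])
  also have "\<dots> = 1"
    by (simp add: prob_space)
  finally show ?thesis
    unfolding variance_eq[OF i(1,3)] variance_eq[OF i(2,4)]
    unfolding cos sin by (simp add: \<phi>_def flip: exp_double)
qed

end

section \<open>The exponent of the stable Levy measure\<close>

lemma Gamma_has_integral:
  assumes "0 < (s::real)"
  shows "(\<lambda>t. t powr (s - 1) * exp (- t)) absolutely_integrable_on {0<..}"
    and "integral {0<..} (\<lambda>t. t powr (s - 1) * exp (- t)) = Gamma s"
proof -
  have "((\<lambda>t. t powr (s - 1) / exp t) has_integral Gamma s) {0<..}"
  proof (subst has_integral_spike_set_eq)
    show "((\<lambda>t. t powr (s - 1) / exp t) has_integral Gamma s) {0..}"
      by (rule Gamma_integral_real[OF assms])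
  qed (auto intro: negligible_subset[of "{0}"])
  then have *: "((\<lambda>t. t powr (s - 1) * exp (- t)) has_integral Gamma s) {0<..}"
    by (simp add: exp_minus divide_inverse)
  then show "integral {0<..} (\<lambda>t. t powr (s - 1) * exp (- t)) = Gamma s"
    by (rule integral_unique)
  show "(\<lambda>t. t powr (s - 1) * exp (- t)) absolutely_integrable_on {0<..}"
    using * by (intro nonnegative_absolutely_integrable_1) (auto simp: has_integral_integrable)
qed

text \<open>Change of variables by a bijection that may be decreasing, which the absolute value of
  the derivative accounts for. It serves both \<open>t \<mapsto> r * t\<close> and
  \<open>t \<mapsto> a / t\<close>.\<close>

lemma nn_integral_Gamma_substitution:
  fixes g g' :: "real \<Rightarrow> real"
  assumes s: "0 < s"
    and g: "\<And>t. 0 < t \<Longrightarrow> (g has_field_derivative g' t) (at t)" "bij_betw g {0<..} {0<..}"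
  shows "(\<integral>\<^sup>+t. ennreal (\<bar>g' t\<bar> * (g t powr (s - 1) * exp (- g t))) * indicator {0<..} t \<partial>lborel)
    = ennreal (Gamma s)"
proof -
  let ?f = "\<lambda>t. t powr (s - 1) * exp (- t)"
  have "(\<lambda>t. \<bar>g' t\<bar> * ?f (g t)) absolutely_integrable_on {0<..} \<and>
      integral {0<..} (\<lambda>t. \<bar>g' t\<bar> * ?f (g t)) = Gamma s"
  proof (rule has_absolute_integral_change_of_variables_1'[of "{0<..}" g g' ?f "Gamma s", THEN iffD2])
    show "(g has_field_derivative g' t) (at t within {0<..})" if "t \<in> {0<..}" for t
      using g(1)[of t] that by (auto intro: has_field_derivative_at_within)
    show "inj_on g {0<..}"
      using g(2) by (simp add: bij_betw_def)
    show "?f absolutely_integrable_on g ` {0<..} \<and> integral (g ` {0<..}) ?f = Gamma s"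
      using g(2) Gamma_has_integral[OF s] by (simp add: bij_betw_def)
  qed simp
  then have "((\<lambda>t. \<bar>g' t\<bar> * ?f (g t)) has_integral Gamma s) {0<..}"
    by (metis has_integral_integral set_lebesgue_integral_eq_integral(1))
  then show ?thesis
    by (intro nn_integral_has_integral_lebesgue') auto
qed

lemma nn_integral_Gamma_scale:
  assumes s: "0 < s" and r: "0 < r"
  shows "(\<integral>\<^sup>+t. ennreal (t powr (s - 1) * exp (- r * t)) * indicator {0<..} t \<partial>lborel)
    = ennreal (Gamma s / r powr s)"
proof -
  have "bij_betw ((*) r) {0<..} {0<..}"
    using r by (intro bij_betwI[where g = "\<lambda>t. t / r"]) auto
  then have "ennreal (Gamma s) = (\<integral>\<^sup>+t. ennreal (\<bar>r\<bar> * ((r * t) powr (s - 1) * exp (- (r * t)))) * indicator {0<..} t \<partial>lborel)"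
    using nn_integral_Gamma_substitution[OF s, of "(*) r" "\<lambda>_. r"]
    by (auto intro!: derivative_eq_intros)
  also have "\<dots> = (\<integral>\<^sup>+t. ennreal (r powr s) * (ennreal (t powr (s - 1) * exp (- r * t)) * indicator {0<..} t) \<partial>lborel)"
    using r by (intro nn_integral_cong)
      (auto simp: powr_mult powr_diff field_simps simp flip: ennreal_mult split: split_indicator)
  also have "\<dots> = ennreal (r powr s) * (\<integral>\<^sup>+t. ennreal (t powr (s - 1) * exp (- r * t)) * indicator {0<..} t \<partial>lborel)"
    by (rule nn_integral_cmult) measurable
  finally have *: "ennreal (Gamma s) = \<dots>" .
  have "ennreal (Gamma s / r powr s) = ennreal (1 / r powr s) * ennreal (Gamma s)"
    using r s by (simp add: Gamma_real_pos flip: ennreal_mult)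
  also have "\<dots> = (\<integral>\<^sup>+t. ennreal (t powr (s - 1) * exp (- r * t)) * indicator {0<..} t \<partial>lborel)"
    unfolding * using r by (simp add: mult.assoc[symmetric] flip: ennreal_mult)
  finally show ?thesis ..
qed

lemma nn_integral_Gamma_inverse:
  assumes q: "0 < q" and a: "0 < a"
  shows "(\<integral>\<^sup>+t. ennreal (t powr (- q - 1) * exp (- a / t)) * indicator {0<..} t \<partial>lborel)
    = ennreal (Gamma q * a powr (- q))"
proof -
  have "bij_betw ((/) a) {0<..} {0<..}"
    using a by (intro bij_betwI[where g = "(/) a"]) auto
  then have "ennreal (Gamma q) = (\<integral>\<^sup>+t. ennreal (\<bar>- a / t\<^sup>2\<bar> * ((a / t) powr (q - 1) * exp (- (a / t)))) * indicator {0<..} t \<partial>lborel)"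
    by (intro nn_integral_Gamma_substitution[OF q, symmetric])
      (auto intro!: derivative_eq_intros simp: power2_eq_square)
  also have "\<dots> = (\<integral>\<^sup>+t. ennreal (a powr q) * (ennreal (t powr (- q - 1) * exp (- a / t)) * indicator {0<..} t) \<partial>lborel)"
  proof (intro nn_integral_cong)
    fix t :: real
    have "a / t\<^sup>2 * ((a / t) powr (q - 1)) = a powr q * t powr (- q - 1)" if "0 < t"
      using that a by (simp add: powr_divide powr_diff powr_minus power2_eq_square field_simps)
    then have *: "a / t\<^sup>2 * ((a / t) powr (q - 1)) * exp (- (a / t)) = a powr q * t powr (- q - 1) * exp (- (a / t))" if "0 < t"
      by (simp only: that)
    show "ennreal (\<bar>- a / t\<^sup>2\<bar> * ((a / t) powr (q - 1) * exp (- (a / t)))) * indicator {0<..} t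
        = ennreal (a powr q) * (ennreal (t powr (- q - 1) * exp (- a / t)) * indicator {0<..} t)"
    proof (cases "0 < t")
      case True
      then show ?thesis
        using *[OF True] a by (simp add: mult.assoc flip: ennreal_mult)
    qed simp
  qed
  also have "\<dots> = ennreal (a powr q) * (\<integral>\<^sup>+t. ennreal (t powr (- q - 1) * exp (- a / t)) * indicator {0<..} t \<partial>lborel)"
    by (rule nn_integral_cmult) measurable
  finally have *: "ennreal (Gamma q) = \<dots>" .
  have "ennreal (Gamma q * a powr (- q)) = ennreal (a powr (- q)) * ennreal (Gamma q)"
    using a q by (simp add: Gamma_real_pos mult.commute flip: ennreal_mult)
  also have "\<dots> = (\<integral>\<^sup>+t. ennreal (t powr (- q - 1) * exp (- a / t)) * indicator {0<..} t \<partial>lborel)"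
    unfolding * using a by (simp add: mult.assoc[symmetric] powr_minus flip: ennreal_mult)
  finally show ?thesis ..
qed

section \<open>Fourier transforms of Gaussians\<close>

lemma gaussian_fourier_real:
  fixes a t :: real
  assumes t: "0 < t"
  shows "integrable lborel (\<lambda>x. iexp (a * x) * of_real (exp (- t * x\<^sup>2)))"
    and "(\<integral>x. iexp (a * x) * of_real (exp (- t * x\<^sup>2)) \<partial>lborel) = of_real (sqrt (pi / t) * exp (- a\<^sup>2 / (4 * t)))"
proof -
  \<comment> \<open>With \<open>y = c * x\<close> the function \<open>exp (- t * x^2)\<close>
    becomes \<open>exp (- y^2 / 2)\<close>, so the characteristic function of the standard normal
    law applies.\<close>
  define c where "c = sqrt (2 * t)"
  have c: "0 < c" "c\<^sup>2 = 2 * t"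
    using t by (auto simp: c_def)
  have density: "iexp (a * x) * of_real (exp (- t * x\<^sup>2))
      = of_real (sqrt (2 * pi)) * (std_normal_density (0 + c * x) *\<^sub>R iexp ((a / c) * (0 + c * x)))" for x
    using c by (simp add: std_normal_density_def power_mult_distrib scaleR_conv_of_real mult.commute)
  have "integrable std_normal_distribution (\<lambda>y. iexp ((a / c) * y))"
  proof -
    interpret real_distribution std_normal_distribution by (rule real_dist_normal_dist)
    show ?thesis by (rule integrable_const_bound[of _ 1]) auto
  qed
  then have i: "integrable lborel (\<lambda>y. std_normal_density y *\<^sub>R iexp ((a / c) * y))"
    by (subst (asm) integrable_density) auto
  show "integrable lborel (\<lambda>x. iexp (a * x) * of_real (exp (- t * x\<^sup>2)))"
    unfolding density using c by (intro integrable_mult_right lborel_integrable_real_affine[OF i]) auto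
  have "complex_of_real (exp (- (a / c)\<^sup>2 / 2)) = (\<integral>y. iexp ((a / c) * y) \<partial>std_normal_distribution)"
    using fun_cong[OF char_std_normal_distribution, of "a / c"] unfolding char_def by (rule sym)
  also have "\<dots> = (\<integral>y. std_normal_density y *\<^sub>R iexp ((a / c) * y) \<partial>lborel)"
    by (rule integral_density) auto
  also have "\<dots> = c *\<^sub>R (\<integral>x. std_normal_density (0 + c * x) *\<^sub>R iexp ((a / c) * (0 + c * x)) \<partial>lborel)"
    using c lborel_integral_real_affine[of c "\<lambda>y. std_normal_density y *\<^sub>R iexp ((a / c) * y)" 0] by simp
  finally have *: "(\<integral>x. std_normal_density (0 + c * x) *\<^sub>R iexp ((a / c) * (0 + c * x)) \<partial>lborel)
      = of_real (exp (- (a / c)\<^sup>2 / 2)) /\<^sub>R c"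
    using c by (simp add: field_simps)
  have "sqrt (2 * pi) / c = sqrt (pi / t)"
    by (simp add: c_def real_sqrt_mult real_sqrt_divide)
  moreover have "- (a / c)\<^sup>2 / 2 = - a\<^sup>2 / (4 * t)"
    by (simp add: power_divide c)
  moreover have "of_real r * (of_real s /\<^sub>R c) = complex_of_real (r / c * s)" for r s
    by (simp add: scaleR_conv_of_real divide_inverse)
  ultimately show "(\<integral>x. iexp (a * x) * of_real (exp (- t * x\<^sup>2)) \<partial>lborel) = of_real (sqrt (pi / t) * exp (- a\<^sup>2 / (4 * t)))"
    unfolding density integral_mult_right_zero * by (simp only:)
qed

text \<open>Lebesgue measure is the image of a product of one-dimensional Lebesgue measures under
  expansion in the basis, so Fubini's theorem for products of one-coordinate functions
  applies.\<close>

lemma lborel_integral_prod_Basis: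
  fixes g :: "'a::euclidean_space \<Rightarrow> real \<Rightarrow> complex"
  assumes g: "\<And>b. b \<in> Basis \<Longrightarrow> integrable lborel (g b)"
  shows "(\<integral>u. (\<Prod>b\<in>Basis. g b (u \<bullet> b)) \<partial>lborel) = (\<Prod>b\<in>Basis. (\<integral>x. g b x \<partial>lborel))"
proof -
  interpret product_sigma_finite "\<lambda>_::'a. lborel :: real measure" ..
  have meas: "g b \<in> borel_measurable borel" if "b \<in> Basis" for b
    using borel_measurable_integrable[OF g[OF that]] by simp
  have "(lborel :: 'a measure) = distr (\<Pi>\<^sub>M b\<in>Basis. lborel) borel (\<lambda>f. \<Sum>b\<in>Basis. f b *\<^sub>R b)"
    unfolding lborel_eq_real by (rule lborel_def)
  then have "(\<integral>u. (\<Prod>b\<in>Basis. g b (u \<bullet> b)) \<partial>lborel)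
      = (\<integral>u. (\<Prod>b\<in>Basis. g b (u \<bullet> b)) \<partial>distr (\<Pi>\<^sub>M b\<in>Basis. lborel) borel (\<lambda>f. \<Sum>b\<in>Basis. f b *\<^sub>R b :: 'a))"
    by (rule arg_cong[where f = "\<lambda>M. \<integral>u. (\<Prod>b\<in>Basis. g b (u \<bullet> b)) \<partial>M"])
  also have "\<dots> = (\<integral>f. (\<Prod>b\<in>Basis. g b ((\<Sum>b\<in>Basis. f b *\<^sub>R b :: 'a) \<bullet> b)) \<partial>(\<Pi>\<^sub>M b\<in>Basis. lborel))"
  proof (rule integral_distr)
    show "(\<lambda>f. \<Sum>b\<in>Basis. f b *\<^sub>R b :: 'a) \<in> (\<Pi>\<^sub>M b\<in>Basis. lborel) \<rightarrow>\<^sub>M borel"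
    proof (intro borel_measurable_sum borel_measurable_scaleR borel_measurable_const)
      fix b :: 'a
      assume "b \<in> Basis"
      then have "(\<lambda>f. f b) \<in> (\<Pi>\<^sub>M b\<in>(Basis::'a set). (lborel :: real measure)) \<rightarrow>\<^sub>M lborel"
        by (rule measurable_component_singleton)
      then show "(\<lambda>f. f b) \<in> (\<Pi>\<^sub>M b\<in>(Basis::'a set). (lborel :: real measure)) \<rightarrow>\<^sub>M borel"
        by (simp only: measurable_lborel1)
    qed
    show "(\<lambda>u::'a. \<Prod>b\<in>Basis. g b (u \<bullet> b)) \<in> borel_measurable borel"
    proof (intro borel_measurable_prod)
      fix b :: 'a
      assume "b \<in> Basis"
      have "(\<lambda>u::'a. u \<bullet> b) \<in> borel_measurable borel" by measurable
      then show "(\<lambda>u. g b (u \<bullet> b)) \<in> borel_measurable borel"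
        by (rule measurable_compose[OF _ meas[OF \<open>b \<in> Basis\<close>]])
    qed
  qed
  also have "\<dots> = (\<integral>f. (\<Prod>b\<in>Basis. g b (f b)) \<partial>(\<Pi>\<^sub>M b\<in>(Basis::'a set). lborel))"
    by (simp only: inner_sum_left_Basis cong: prod.cong)
  also have "\<dots> = (\<Prod>b\<in>Basis. (\<integral>x. g b x \<partial>lborel))"
    by (rule product_integral_prod[OF finite_Basis g])
  finally show ?thesis .
qed

lemma gaussian_fourier:
  fixes \<xi> :: "'a::euclidean_space"
  assumes t: "0 < t"
  shows "(\<integral>u. iexp (\<xi> \<bullet> u) * of_real (exp (- t * (norm u)\<^sup>2)) \<partial>lborel)
    = of_real ((pi / t) powr (real DIM('a) / 2) * exp (- (norm \<xi>)\<^sup>2 / (4 * t)))"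
proof -
  let ?g = "\<lambda>b x. iexp ((\<xi> \<bullet> b) * x) * complex_of_real (exp (- t * x\<^sup>2))"
  have norm: "(norm v)\<^sup>2 = (\<Sum>b\<in>Basis. (v \<bullet> b)\<^sup>2)" for v :: 'a
    unfolding power2_norm_eq_inner by (subst euclidean_inner) (simp add: power2_eq_square)
  have eq: "iexp (\<xi> \<bullet> u) * of_real (exp (- t * (norm u)\<^sup>2)) = (\<Prod>b\<in>Basis. ?g b (u \<bullet> b))" for u
    by (simp add: norm euclidean_inner[of \<xi> u] sum_distrib_left prod.distrib flip: exp_sum exp_of_real sum_negf)
  have "(\<integral>u. iexp (\<xi> \<bullet> u) * of_real (exp (- t * (norm u)\<^sup>2)) \<partial>lborel)
      = (\<Prod>b\<in>Basis. (\<integral>x. ?g b x \<partial>lborel))"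
    unfolding eq by (rule lborel_integral_prod_Basis[OF gaussian_fourier_real(1)[OF t]])
  also have "\<dots> = of_real (\<Prod>b\<in>Basis. sqrt (pi / t) * exp (- (\<xi> \<bullet> b)\<^sup>2 / (4 * t)))"
    by (simp only: gaussian_fourier_real(2)[OF t] of_real_prod)
  also have "(\<Prod>b\<in>(Basis::'a set). sqrt (pi / t) * exp (- (\<xi> \<bullet> b)\<^sup>2 / (4 * t)))
      = (pi / t) powr (real DIM('a) / 2) * exp (- (norm \<xi>)\<^sup>2 / (4 * t))"
  proof -
    have "sqrt (pi / t) ^ DIM('a) = (pi / t) powr (real DIM('a) / 2)"
      using t by (simp add: powr_half_sqrt[symmetric] powr_powr mult.commute flip: powr_realpow)
    then show ?thesis
      by (simp add: prod.distrib norm sum_divide_distrib flip: exp_sum sum_negf)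
  qed
  finally show ?thesis .
qed

lemma gaussian_one_minus_cos:
  fixes \<xi> :: "'a::euclidean_space"
  assumes t: "0 < t"
  shows "(\<integral>\<^sup>+u. ennreal ((1 - cos (\<xi> \<bullet> u)) * exp (- t * (norm u)\<^sup>2)) \<partial>lborel)
    = ennreal ((pi / t) powr (real DIM('a) / 2) * (1 - exp (- (norm \<xi>)\<^sup>2 / (4 * t))))"
proof -
  let ?e = "\<lambda>u::'a. exp (- t * (norm u)\<^sup>2)" and ?c = "(pi / t) powr (real DIM('a) / 2)"
  have zero: "(\<integral>u. ?e u \<partial>lborel) = ?c"
  proof -
    have "complex_of_real (\<integral>u. ?e u \<partial>lborel) = of_real ?c"
      using gaussian_fourier[OF t, of "0::'a"] by (simp flip: integral_complex_of_real)
    then show ?thesis by (simp only: of_real_eq_iff)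
  qed
  \<comment> \<open>Integrability is read off from the value: a function that is not integrable
    would have Bochner integral \<open>0\<close>.\<close>
  have "?c \<noteq> 0" using t by simp
  then have i: "integrable lborel ?e"
    using zero not_integrable_integral_eq by metis
  have "integrable lborel (\<lambda>u. iexp (\<xi> \<bullet> u) * of_real (?e u))"
    by (rule Bochner_Integration.integrable_bound[OF i]) (auto simp: norm_mult)
  note ic = integrable_Re[OF this] and Re = integral_Re[OF this]
  have ic': "integrable lborel (\<lambda>u. cos (\<xi> \<bullet> u) * ?e u)"
    using ic by (simp add: Re_exp)
  have cos: "(\<integral>u. cos (\<xi> \<bullet> u) * ?e u \<partial>lborel) = ?c * exp (- (norm \<xi>)\<^sup>2 / (4 * t))"
    using Re unfolding gaussian_fourier[OF t] by (simp add: Re_exp)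
  have eq: "(1 - cos (\<xi> \<bullet> u)) * ?e u = ?e u - cos (\<xi> \<bullet> u) * ?e u" for u
    by (simp add: left_diff_distrib)
  have int: "integrable lborel (\<lambda>u. (1 - cos (\<xi> \<bullet> u)) * ?e u)"
    unfolding eq by (intro Bochner_Integration.integrable_diff i ic')
  have "(\<integral>\<^sup>+u. ennreal ((1 - cos (\<xi> \<bullet> u)) * ?e u) \<partial>lborel) = ennreal (\<integral>u. (1 - cos (\<xi> \<bullet> u)) * ?e u \<partial>lborel)"
    by (rule nn_integral_eq_integral[OF int]) simp
  also have "(\<integral>u. (1 - cos (\<xi> \<bullet> u)) * ?e u \<partial>lborel) = ?c * (1 - exp (- (norm \<xi>)\<^sup>2 / (4 * t)))"
    unfolding eq Bochner_Integration.integral_diff[OF i ic'] zero cos by (simp add: right_diff_distrib)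
  finally show ?thesis .
qed

text \<open>\<open>1 - exp (- A / t)\<close> is the integral of \<open>exp (- a / t) / t\<close>
  over \<open>0 \<le> a \<le> A\<close>. After Tonelli the integral over \<open>t\<close> is
  \<open>Gamma q * a powr (- q)\<close>, and \<open>q < 1\<close> makes this integrable at
  \<open>0\<close>.\<close>

lemma nn_integral_one_minus_exp_inverse:
  assumes q: "0 < q" "q < 1" and A: "0 \<le> A"
  shows "(\<integral>\<^sup>+t. ennreal (t powr (- q) * (1 - exp (- A / t))) * indicator {0<..} t \<partial>lborel)
    = ennreal (Gamma q * A powr (1 - q) / (1 - q))"
proof -
  have inner: "ennreal (1 - exp (- A / t)) = (\<integral>\<^sup>+a. ennreal (exp (- a / t) / t) * indicator {0..A} a \<partial>lborel)"
    if t: "0 < t" for t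
  proof -
    have "((\<lambda>a. exp (- a / t) / t) has_integral (- exp (- A / t) - (- exp (- 0 / t)))) {0..A}"
      using A t by (intro fundamental_theorem_of_calculus)
        (auto intro!: derivative_eq_intros simp: has_real_derivative_iff_has_vector_derivative[symmetric])
    then show ?thesis
      using t by (subst nn_integral_has_integral_lebesgue') auto
  qed
  have "(\<integral>\<^sup>+t. ennreal (t powr (- q) * (1 - exp (- A / t))) * indicator {0<..} t \<partial>lborel)
      = (\<integral>\<^sup>+t. (\<integral>\<^sup>+a. ennreal (t powr (- q - 1) * exp (- a / t)) * indicator {0<..} t * indicator {0..A} a \<partial>lborel) \<partial>lborel)"
  proof (intro nn_integral_cong)
    fix t :: real
    show "ennreal (t powr (- q) * (1 - exp (- A / t))) * indicator {0<..} t
        = (\<integral>\<^sup>+a. ennreal (t powr (- q - 1) * exp (- a / t)) * indicator {0<..} t * indicator {0..A} a \<partial>lborel)"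
    proof (cases "0 < t")
      case True
      have "ennreal (t powr (- q) * (1 - exp (- A / t))) = ennreal (t powr (- q)) * ennreal (1 - exp (- A / t))"
        by (rule ennreal_mult') simp
      also have "\<dots> = (\<integral>\<^sup>+a. ennreal (t powr (- q)) * (ennreal (exp (- a / t) / t) * indicator {0..A} a) \<partial>lborel)"
        unfolding inner[OF True] by (rule nn_integral_cmult[symmetric]) measurable
      also have "\<dots> = (\<integral>\<^sup>+a. ennreal (t powr (- q - 1) * exp (- a / t)) * indicator {0..A} a \<partial>lborel)"
      proof (intro nn_integral_cong)
        fix a :: real
        have "t powr (- q) * (exp (- a / t) / t) = t powr (- q - 1) * exp (- a / t)"
          using True by (simp add: powr_diff)
        then show "ennreal (t powr (- q)) * (ennreal (exp (- a / t) / t) * indicator {0..A} a)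
            = ennreal (t powr (- q - 1) * exp (- a / t)) * indicator {0..A} a"
          using True by (simp add: mult.assoc[symmetric] flip: ennreal_mult)
      qed
      finally show ?thesis
        using True by simp
    qed simp
  qed
  also have "\<dots> = (\<integral>\<^sup>+a. (\<integral>\<^sup>+t. ennreal (t powr (- q - 1) * exp (- a / t)) * indicator {0<..} t * indicator {0..A} a \<partial>lborel) \<partial>lborel)"
    by (rule lborel_pair.Fubini') measurable
  also have "\<dots> = (\<integral>\<^sup>+a. ennreal (Gamma q * a powr (- q)) * indicator {0..A} a \<partial>lborel)"
  proof (rule nn_integral_cong_AE)
    \<comment> \<open>At \<open>a = 0\<close> the inner integral diverges whereas
      \<open>0 powr (- q)\<close> is \<open>0\<close>; the point is a null set.\<close>
    have "AE a in lborel. a \<noteq> (0::real)"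
      by (rule AE_lborel_singleton)
    then show "AE a in lborel. (\<integral>\<^sup>+t. ennreal (t powr (- q - 1) * exp (- a / t)) * indicator {0<..} t * indicator {0..A} a \<partial>lborel)
        = ennreal (Gamma q * a powr (- q)) * indicator {0..A} a"
    proof eventually_elim
      case (elim a)
      show ?case
      proof (cases "a \<in> {0..A}")
        case True
        with elim nn_integral_Gamma_inverse[OF q(1), of a] show ?thesis by simp
      qed simp
    qed
  qed
  also have "\<dots> = ennreal (Gamma q * A powr (1 - q) / (1 - q))"
  proof (rule nn_integral_has_integral_lebesgue')
    have "((\<lambda>a. a powr (- q)) has_integral (A powr (- q + 1) / (- q + 1))) {0..A}"
      using q A by (intro has_integral_powr_from_0) auto
    from has_integral_mult_right[OF this, of "Gamma q"]
    show "((\<lambda>a. Gamma q * a powr (- q)) has_integral (Gamma q * A powr (1 - q) / (1 - q))) {0..A}"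
      by simp
  qed (use q in \<open>simp add: Gamma_real_pos less_imp_le\<close>)
  finally show ?thesis .
qed

text \<open>The Gaussian mixture: for \<open>s = (d + \<alpha>) / 2\<close>,
  \<open>Gamma s / norm u powr (2 * s)\<close> is the integral of
  \<open>t powr (s - 1) * exp (- t * (norm u)^2)\<close> over \<open>t > 0\<close>. Tonelli reduces
  the claim to Gaussians. Keeping the Gamma factor on the left avoids division of extended
  reals.\<close>

lemma nn_integral_one_minus_cos_riesz:
  fixes \<xi> :: "'a::euclidean_space"
  assumes \<alpha>: "0 < \<alpha>" "\<alpha> < 2"
  shows "ennreal (Gamma ((real DIM('a) + \<alpha>) / 2)) *
      (\<integral>\<^sup>+u. ennreal ((1 - cos (\<xi> \<bullet> u)) / norm u powr (real DIM('a) + \<alpha>)) \<partial>lborel)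
    = ennreal (pi powr (real DIM('a) / 2) * (Gamma (1 - \<alpha> / 2) * ((norm \<xi>)\<^sup>2 / 4) powr (\<alpha> / 2) / (\<alpha> / 2)))"
proof -
  let ?d = "real DIM('a)"
  define s where "s = (?d + \<alpha>) / 2"
  have s: "0 < s" using \<alpha> by (simp add: s_def add_pos_pos)
  let ?k = "\<lambda>(u::'a) t. ennreal (t powr (s - 1) * ((1 - cos (\<xi> \<bullet> u)) * exp (- t * (norm u)\<^sup>2))) * indicator {0<..} t"
  have inner: "ennreal (Gamma s) * ennreal ((1 - cos (\<xi> \<bullet> u)) / norm u powr (?d + \<alpha>)) = (\<integral>\<^sup>+t. ?k u t \<partial>lborel)"
    if "u \<noteq> 0" for u
  proof -
    have norm_pos: "0 < (norm u)\<^sup>2"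
      using that by simp
    have "((norm u)\<^sup>2) powr s = norm u powr (2 * s)"
      using that by (simp add: powr_powr flip: powr_numeral)
    also have "2 * s = ?d + \<alpha>"
      by (simp add: s_def)
    finally have "((norm u)\<^sup>2) powr s = norm u powr (?d + \<alpha>)" .
    then have "ennreal (Gamma s) * ennreal ((1 - cos (\<xi> \<bullet> u)) / norm u powr (?d + \<alpha>))
        = ennreal (1 - cos (\<xi> \<bullet> u)) * ennreal (Gamma s / ((norm u)\<^sup>2) powr s)"
      using s by (simp add: Gamma_real_pos less_imp_le mult.commute flip: ennreal_mult)
    also have "\<dots> = (\<integral>\<^sup>+t. ennreal (1 - cos (\<xi> \<bullet> u)) * (ennreal (t powr (s - 1) * exp (- (norm u)\<^sup>2 * t)) * indicator {0<..} t) \<partial>lborel)"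
      unfolding nn_integral_Gamma_scale[OF s norm_pos, symmetric]
      by (rule nn_integral_cmult[symmetric]) measurable
    also have "\<dots> = (\<integral>\<^sup>+t. ?k u t \<partial>lborel)"
    proof (intro nn_integral_cong)
      fix t
      have "t powr (s - 1) * ((1 - cos (\<xi> \<bullet> u)) * exp (- t * (norm u)\<^sup>2))
          = (1 - cos (\<xi> \<bullet> u)) * (t powr (s - 1) * exp (- (norm u)\<^sup>2 * t))"
        by simp
      then show "ennreal (1 - cos (\<xi> \<bullet> u)) * (ennreal (t powr (s - 1) * exp (- (norm u)\<^sup>2 * t)) * indicator {0<..} t) = ?k u t"
        by (simp only: ennreal_mult'[of "1 - cos (\<xi> \<bullet> u)"] cos_le_one diff_ge_0_iff_ge mult.assoc)
    qed
    finally show ?thesis .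
  qed
  have "ennreal (Gamma s) * (\<integral>\<^sup>+u. ennreal ((1 - cos (\<xi> \<bullet> u)) / norm u powr (?d + \<alpha>)) \<partial>lborel)
      = (\<integral>\<^sup>+u. ennreal (Gamma s) * ennreal ((1 - cos (\<xi> \<bullet> u)) / norm u powr (?d + \<alpha>)) \<partial>lborel)"
    by (rule nn_integral_cmult[symmetric]) measurable
  also have "\<dots> = (\<integral>\<^sup>+u. (\<integral>\<^sup>+t. ?k u t \<partial>lborel) \<partial>lborel)"
  proof (rule nn_integral_cong_AE)
    have "AE u in lborel. u \<noteq> (0::'a)"
      by (rule AE_lborel_singleton)
    then show "AE u in lborel. ennreal (Gamma s) * ennreal ((1 - cos (\<xi> \<bullet> u)) / norm u powr (?d + \<alpha>)) = (\<integral>\<^sup>+t. ?k u t \<partial>lborel)"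
      by eventually_elim (rule inner)
  qed
  also have "\<dots> = (\<integral>\<^sup>+t. (\<integral>\<^sup>+u. ?k u t \<partial>lborel) \<partial>lborel)"
    by (rule lborel_pair.Fubini'[symmetric]) measurable
  also have "\<dots> = (\<integral>\<^sup>+t. ennreal (pi powr (?d / 2)) *
      (ennreal (t powr (- (1 - \<alpha> / 2)) * (1 - exp (- ((norm \<xi>)\<^sup>2 / 4) / t))) * indicator {0<..} t) \<partial>lborel)"
  proof (intro nn_integral_cong)
    fix t :: real
    show "(\<integral>\<^sup>+u. ?k u t \<partial>lborel) = ennreal (pi powr (?d / 2)) *
      (ennreal (t powr (- (1 - \<alpha> / 2)) * (1 - exp (- ((norm \<xi>)\<^sup>2 / 4) / t))) * indicator {0<..} t)"
    proof (cases "0 < t")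
      case True
      have "(\<integral>\<^sup>+u. ?k u t \<partial>lborel)
          = (\<integral>\<^sup>+u. ennreal (t powr (s - 1)) * ennreal ((1 - cos (\<xi> \<bullet> u)) * exp (- t * (norm u)\<^sup>2)) \<partial>lborel)"
        using True by (intro nn_integral_cong) (simp add: ennreal_mult')
      also have "\<dots> = ennreal (t powr (s - 1)) * ennreal ((pi / t) powr (?d / 2) * (1 - exp (- (norm \<xi>)\<^sup>2 / (4 * t))))"
        unfolding gaussian_one_minus_cos[OF True, symmetric] by (rule nn_integral_cmult) measurable
      also have "\<dots> = ennreal (t powr (s - 1) * ((pi / t) powr (?d / 2) * (1 - exp (- (norm \<xi>)\<^sup>2 / (4 * t)))))"
        by (rule ennreal_mult'[symmetric]) simp
      also have "t powr (s - 1) * ((pi / t) powr (?d / 2) * (1 - exp (- (norm \<xi>)\<^sup>2 / (4 * t))))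
          = pi powr (?d / 2) * (t powr (- (1 - \<alpha> / 2)) * (1 - exp (- ((norm \<xi>)\<^sup>2 / 4) / t)))"
      proof -
        \<comment> \<open>The dimension cancels: \<open>s - 1 - d / 2 = \<alpha> / 2 - 1\<close>,
          the exponent \<open>- q\<close> with \<open>q = 1 - \<alpha> / 2\<close>.\<close>
        have "t powr (s - 1) * (pi / t) powr (?d / 2) = pi powr (?d / 2) * (t powr (s - 1) / t powr (?d / 2))"
          using True by (simp add: powr_divide)
        also have "t powr (s - 1) / t powr (?d / 2) = t powr (- (1 - \<alpha> / 2))"
          by (simp add: s_def add_divide_distrib flip: powr_diff)
        finally show ?thesis
          by (simp add: mult.assoc[symmetric])
      qed
      finally show ?thesis
        using True by (simp add: ennreal_mult')
    qed simp
  qed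
  also have "\<dots> = ennreal (pi powr (?d / 2)) * ennreal (Gamma (1 - \<alpha> / 2) * ((norm \<xi>)\<^sup>2 / 4) powr (\<alpha> / 2) / (\<alpha> / 2))"
    using nn_integral_one_minus_exp_inverse[of "1 - \<alpha> / 2" "(norm \<xi>)\<^sup>2 / 4"] \<alpha>
    by (subst nn_integral_cmult) auto
  also have "\<dots> = ennreal (pi powr (?d / 2) * (Gamma (1 - \<alpha> / 2) * ((norm \<xi>)\<^sup>2 / 4) powr (\<alpha> / 2) / (\<alpha> / 2)))"
    by (rule ennreal_mult'[symmetric]) simp
  finally show ?thesis
    unfolding s_def .
qed

section \<open>Gamma identities and the normalising constant\<close>

lemma Gamma_legendre_duplication_real:
  assumes z: "0 < (z::real)"
  shows "Gamma z * Gamma (z + 1 / 2) = 2 powr (1 - 2 * z) * sqrt pi * Gamma (2 * z)"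
proof -
  have notin: "complex_of_real x \<notin> \<int>\<^sub>\<le>\<^sub>0" if "0 < x" for x
  proof
    assume "complex_of_real x \<in> \<int>\<^sub>\<le>\<^sub>0"
    then obtain n where "complex_of_real x = of_int n" "n \<le> 0"
      by (rule nonpos_Ints_cases)
    from arg_cong[OF this(1), of Re] this(2) that show False
      by simp
  qed
  have "complex_of_real z + 1 / 2 \<notin> \<int>\<^sub>\<le>\<^sub>0"
    using notin[of "z + 1 / 2"] z by simp
  from Gamma_legendre_duplication[OF notin[OF z] this]
  have "Gamma (complex_of_real z) * Gamma (complex_of_real z + 1 / 2)
      = exp ((1 - 2 * complex_of_real z) * of_real (ln 2)) * of_real (sqrt pi) * Gamma (2 * complex_of_real z)" .
  also have "Gamma (complex_of_real z + 1 / 2) = of_real (Gamma (z + 1 / 2))"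
    by (subst Gamma_complex_of_real[symmetric]) simp
  also have "Gamma (2 * complex_of_real z) = of_real (Gamma (2 * z))"
    by (subst Gamma_complex_of_real[symmetric]) simp
  also have "exp ((1 - 2 * complex_of_real z) * of_real (ln 2)) = of_real (2 powr (1 - 2 * z))"
    unfolding powr_def by (simp flip: exp_of_real)
  finally have "complex_of_real (Gamma z * Gamma (z + 1 / 2))
      = of_real (2 powr (1 - 2 * z) * sqrt pi * Gamma (2 * z))"
    by (simp add: Gamma_complex_of_real)
  then show ?thesis by (simp only: of_real_eq_iff)
qed

lemma Gamma_reflection_real: "Gamma z * Gamma (1 - z) = pi / sin (pi * z)" for z :: real
proof -
  have "1 - complex_of_real z = of_real (1 - z)" "of_real pi * complex_of_real z = of_real (pi * z)"
    by simp_all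
  note eq = this
  have "complex_of_real (Gamma z * Gamma (1 - z)) = of_real (pi / sin (pi * z))"
    using Gamma_reflection_complex[of "complex_of_real z"]
    unfolding eq Gamma_complex_of_real sin_of_real of_real_mult[of "Gamma z"] of_real_divide .
  then show ?thesis by (simp only: of_real_eq_iff)
qed

lemma cos_stable_neg:
  assumes "1 < \<alpha>" "\<alpha> < 2"
  shows "cos (\<alpha> * pi / 2) < 0"
proof -
  have "0 < cos (pi - \<alpha> * pi / 2)"
    using assms by (intro cos_gt_zero_pi) (simp_all add: field_simps)
  then show ?thesis by simp
qed

text \<open>The minus sign of the numerator is matched by the negative cosine in the
  denominator.\<close>

lemma stable_const_pos:
  assumes \<alpha>: "1 < \<alpha>" "\<alpha> < 2"
  shows "0 < stable_const \<alpha> d"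
proof -
  have "stable_const \<alpha> d = (\<alpha> * (\<alpha> - 1) * Gamma ((\<alpha> + real d) / 2)) /
      (4 * (- cos (\<alpha> * pi / 2)) * Gamma ((\<alpha> + 1) / 2) * pi powr ((real d - 1) / 2) * Gamma (2 - \<alpha>))"
    by (simp add: stable_const_def)
  also have "\<dots> > 0"
    using \<alpha> cos_stable_neg[OF \<alpha>] by (intro divide_pos_pos mult_pos_pos) (auto intro: Gamma_real_pos)
  finally show ?thesis .
qed

text \<open>Duplication at \<open>1 - \<alpha> / 2\<close> meets reflection at
  \<open>(\<alpha> + 1) / 2\<close>, which produces the cosine. The value
  \<open>Gamma ((3 - \<alpha>) / 2)\<close>, called \<open>G2\<close>, occurs in both relations and
  cancels.\<close>

lemma stable_const_normalisation:
  assumes \<alpha>: "1 < \<alpha>" "\<alpha> < 2" and n: "0 \<le> n"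
  shows "stable_const \<alpha> d * (pi powr (real d / 2) * (Gamma (1 - \<alpha> / 2) * (n\<^sup>2 / 4) powr (\<alpha> / 2) / (\<alpha> / 2)))
    = Gamma ((real d + \<alpha>) / 2) * (n powr \<alpha> / 2)"
proof -
  define C Ga G1 G2 G3 D where "C = cos (\<alpha> * pi / 2)" and "Ga = Gamma ((\<alpha> + 1) / 2)"
    and "G1 = Gamma (1 - \<alpha> / 2)" and "G2 = Gamma ((3 - \<alpha>) / 2)" and "G3 = Gamma (2 - \<alpha>)"
    and "D = Gamma ((real d + \<alpha>) / 2)"
  have "0 < Ga" "0 < G2" "0 < G3"
    unfolding Ga_def G2_def G3_def by (rule Gamma_real_pos, use \<alpha> in simp)+
  then have nz: "C \<noteq> 0" "Ga \<noteq> 0" "G2 \<noteq> 0" "G3 \<noteq> 0"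
    using cos_stable_neg[OF \<alpha>] by (auto simp: C_def)
  have E1: "G1 * G2 = 2 powr (\<alpha> - 1) * sqrt pi * G3"
    using Gamma_legendre_duplication_real[of "1 - \<alpha> / 2"] \<alpha>
    by (simp add: G1_def G2_def G3_def diff_divide_distrib)
  have "sin (pi * ((\<alpha> + 1) / 2)) = C"
    using sin_add[of "\<alpha> * pi / 2" "pi / 2"] by (simp add: C_def algebra_simps add_divide_distrib)
  then have R: "Ga * Gamma ((1 - \<alpha>) / 2) = pi / C"
    using Gamma_reflection_real[of "(\<alpha> + 1) / 2"] by (simp add: Ga_def diff_divide_distrib add_divide_distrib)
  \<comment> \<open>Reflection leads to the negative argument \<open>(1 - \<alpha>) / 2\<close>,
    which lies strictly between the poles \<open>- 1\<close> and \<open>0\<close>; the functional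
    equation moves it to \<open>(3 - \<alpha>) / 2\<close>.\<close>
  have S: "G2 = (1 - \<alpha>) / 2 * Gamma ((1 - \<alpha>) / 2)"
  proof -
    have "(1 - \<alpha>) / 2 \<notin> \<int>\<^sub>\<le>\<^sub>0"
    proof
      assume "(1 - \<alpha>) / 2 \<in> \<int>\<^sub>\<le>\<^sub>0"
      then obtain k where k: "(1 - \<alpha>) / 2 = of_int k"
        by (auto elim: nonpos_Ints_cases)
      have "- 1 < (1 - \<alpha>) / 2" "(1 - \<alpha>) / 2 < 0"
        using \<alpha> by simp_all
      then show False
        unfolding k by simp
    qed
    from Gamma_plus1[OF this] show ?thesis
      by (simp add: G2_def field_simps)
  qed
  have "Ga * G2 * C = (1 - \<alpha>) / 2 * (Ga * Gamma ((1 - \<alpha>) / 2)) * C"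
    unfolding S by (simp only: mult_ac)
  also have "\<dots> = (1 - \<alpha>) / 2 * pi"
    unfolding R using nz by simp
  finally have E2: "Ga * G2 * C = (1 - \<alpha>) / 2 * pi" .
  have two: "2 powr \<alpha> = 2 * 2 powr (\<alpha> - 1)"
    by (simp add: powr_diff)
  have "C * Ga * G3 * 2 powr \<alpha> * G2 = (Ga * G2 * C) * G3 * 2 powr \<alpha>"
    by (simp only: mult_ac)
  also have "\<dots> = (1 - \<alpha>) * sqrt pi * (2 powr (\<alpha> - 1) * sqrt pi * G3)"
    unfolding E2 two by simp
  also have "\<dots> = (1 - \<alpha>) * sqrt pi * G1 * G2"
    unfolding E1[symmetric] by (simp only: mult_ac)
  finally have key: "(1 - \<alpha>) * sqrt pi * G1 = C * Ga * G3 * 2 powr \<alpha>"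
    using nz by simp
  have square: "(x\<^sup>2) powr (\<alpha> / 2) = x powr \<alpha>" if "0 \<le> x" for x :: real
    using that by (cases "x = 0") (simp_all add: powr_powr flip: powr_numeral)
  have n_powr: "(n\<^sup>2 / 4) powr (\<alpha> / 2) = n powr \<alpha> / 2 powr \<alpha>"
    using square[of "n / 2"] n by (simp add: power_divide powr_divide)
  have "pi powr (real d / 2) = pi powr ((real d - 1) / 2) * pi powr (1 / 2)"
    by (simp add: diff_divide_distrib flip: powr_add)
  then have pi_powr: "pi powr (real d / 2) = pi powr ((real d - 1) / 2) * sqrt pi"
    by (simp add: powr_half_sqrt)
  have "stable_const \<alpha> d * (pi powr (real d / 2) * (G1 * (n\<^sup>2 / 4) powr (\<alpha> / 2) / (\<alpha> / 2)))
      = ((1 - \<alpha>) * sqrt pi * G1) * (D * n powr \<alpha>) / (2 * (C * Ga * G3 * 2 powr \<alpha>))"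
    unfolding stable_const_def n_powr pi_powr C_def[symmetric] Ga_def[symmetric] G3_def[symmetric]
      D_def[unfolded add.commute[of "real d"], symmetric]
    using \<alpha> nz by (simp add: field_simps)
  also have "\<dots> = D * (n powr \<alpha> / 2)"
    unfolding key using nz by simp
  finally show ?thesis
    unfolding G1_def D_def .
qed

lemma stable_levy_exponent:
  fixes \<xi> :: "'a::euclidean_space"
  assumes \<alpha>: "1 < \<alpha>" "\<alpha> < 2"
  shows "(\<integral>\<^sup>+u. ennreal ((1 - cos (\<xi> \<bullet> u)) * (stable_const \<alpha> DIM('a) / norm u powr (real DIM('a) + \<alpha>))) \<partial>lborel)
    = ennreal (norm \<xi> powr \<alpha> / 2)"
proof -
  define I where "I = (\<integral>\<^sup>+u. ennreal ((1 - cos (\<xi> \<bullet> u)) / norm u powr (real DIM('a) + \<alpha>)) \<partial>lborel)"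
  define \<Gamma> where "\<Gamma> = Gamma ((real DIM('a) + \<alpha>) / 2)"
  have \<Gamma>: "0 < \<Gamma>"
    using \<alpha> unfolding \<Gamma>_def by (intro Gamma_real_pos) simp
  have c: "0 < stable_const \<alpha> DIM('a)"
    by (rule stable_const_pos[OF \<alpha>])
  have eq: "ennreal \<Gamma> * I = ennreal (pi powr (real DIM('a) / 2) * (Gamma (1 - \<alpha> / 2) * ((norm \<xi>)\<^sup>2 / 4) powr (\<alpha> / 2) / (\<alpha> / 2)))"
    using nn_integral_one_minus_cos_riesz[of \<alpha> \<xi>] \<alpha> by (simp only: I_def \<Gamma>_def)
  have "(\<integral>\<^sup>+u. ennreal ((1 - cos (\<xi> \<bullet> u)) * (stable_const \<alpha> DIM('a) / norm u powr (real DIM('a) + \<alpha>))) \<partial>lborel)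
      = (\<integral>\<^sup>+u. ennreal (stable_const \<alpha> DIM('a)) * ennreal ((1 - cos (\<xi> \<bullet> u)) / norm u powr (real DIM('a) + \<alpha>)) \<partial>lborel)"
    using c by (intro nn_integral_cong) (simp add: mult.commute flip: ennreal_mult)
  also have "\<dots> = ennreal (stable_const \<alpha> DIM('a)) * I"
    unfolding I_def by (rule nn_integral_cmult) measurable
  also have "\<dots> = ennreal (stable_const \<alpha> DIM('a) / \<Gamma>) * (ennreal \<Gamma> * I)"
    using c \<Gamma> by (simp add: mult.assoc[symmetric] flip: ennreal_mult)
  also have "\<dots> = ennreal (stable_const \<alpha> DIM('a) / \<Gamma> *
      (pi powr (real DIM('a) / 2) * (Gamma (1 - \<alpha> / 2) * ((norm \<xi>)\<^sup>2 / 4) powr (\<alpha> / 2) / (\<alpha> / 2))))"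
    unfolding eq using c \<Gamma> by (intro ennreal_mult'[symmetric]) simp
  also have "stable_const \<alpha> DIM('a) / \<Gamma> *
      (pi powr (real DIM('a) / 2) * (Gamma (1 - \<alpha> / 2) * ((norm \<xi>)\<^sup>2 / 4) powr (\<alpha> / 2) / (\<alpha> / 2)))
      = (\<Gamma> * (norm \<xi> powr \<alpha> / 2)) / \<Gamma>"
    using stable_const_normalisation[OF \<alpha> norm_ge_zero[of \<xi>], of "DIM('a)"]
    unfolding \<Gamma>_def[symmetric] by (simp only: times_divide_eq_left)
  also have "\<dots> = norm \<xi> powr \<alpha> / 2"
    using \<Gamma> by simp
  finally show ?thesis .
qed

section \<open>The stable Poincare constant\<close>

text \<open>The integrability demanded by \<open>levy_weight\<close> comes from the explicit finite
  value of the nonnegative integral, so evaluating the exponent also checks the Levy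
  condition.\<close>

lemma symmetric_jump_law_stable:
  fixes \<mu> :: "'a::euclidean_space measure"
  defines "\<rho> \<equiv> \<lambda>\<alpha> u::'a. stable_const \<alpha> DIM('a) / norm u powr (real DIM('a) + \<alpha>)"
  assumes \<alpha>: "1 < \<alpha>" "\<alpha> < 2" and \<mu>: "prob_space \<mu>" "sets \<mu> = sets borel"
    and char: "\<And>\<xi>. char_fun \<mu> \<xi> = complex_of_real (exp (- (norm \<xi> powr \<alpha>) / 2))"
  shows "symmetric_jump_law \<mu> (\<rho> \<alpha>)" and "levy_exp (\<rho> \<alpha>) \<xi> = norm \<xi> powr \<alpha> / 2"
proof -
  have c: "0 < stable_const \<alpha> DIM('a)"
    by (rule stable_const_pos[OF \<alpha>])
  have [measurable]: "\<rho> \<alpha> \<in> borel_measurable borel"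
    unfolding \<rho>_def by measurable
  have nn: "0 \<le> \<rho> \<alpha> u" for u
    using c by (simp add: \<rho>_def)
  have val: "(\<integral>\<^sup>+u. ennreal ((1 - cos (\<xi> \<bullet> u)) * \<rho> \<alpha> u) \<partial>lborel) = ennreal (norm \<xi> powr \<alpha> / 2)" for \<xi>
    unfolding \<rho>_def by (rule stable_levy_exponent[OF \<alpha>])
  have int: "integrable lborel (\<lambda>u. (1 - cos (\<xi> \<bullet> u)) * \<rho> \<alpha> u)" for \<xi>
    by (rule integrableI_nn_integral_finite[OF _ _ val]) (auto simp: nn)
  have weight: "levy_weight (\<rho> \<alpha>)"
    using int nn by (simp add: levy_weight_def)
  show exponent: "levy_exp (\<rho> \<alpha>) \<xi> = norm \<xi> powr \<alpha> / 2" for \<xi>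
    using nn_integral_eq_integral[OF int, of \<xi>] nn unfolding val levy_exp_def by simp
  show "symmetric_jump_law \<mu> (\<rho> \<alpha>)"
  proof (intro symmetric_jump_law.intro symmetric_jump_law_axioms.intro \<mu> weight)
    show "\<rho> \<alpha> (- u) = \<rho> \<alpha> u" for u
      by (simp add: \<rho>_def)
    show "char_fun \<mu> \<xi> = complex_of_real (exp (- levy_exp (\<rho> \<alpha>) \<xi>))" for \<xi>
      by (simp add: char exponent)
  qed
qed

lemma stable_energy_eq_jump_energy:
  fixes f :: "'a::euclidean_space \<Rightarrow> real"
  assumes \<alpha>: "1 < \<alpha>" "\<alpha> < 2" and [measurable]: "f \<in> borel_measurable borel"
  shows "stable_energy \<alpha> \<mu> f = jump_energy \<mu>
    (\<lambda>u. stable_const \<alpha> DIM('a) / norm u powr (real DIM('a) + \<alpha>)) (\<lambda>x. of_real (f x))"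
  unfolding stable_energy_def jump_energy_def stable_levy_measure_def
proof (rule nn_integral_cong)
  fix x
  let ?\<rho> = "\<lambda>u::'a. stable_const \<alpha> DIM('a) / norm u powr (real DIM('a) + \<alpha>)"
  have "(\<integral>\<^sup>+u. ennreal (\<bar>f (x + u) - f x\<bar>\<^sup>2) \<partial>density lborel (\<lambda>u. ennreal (?\<rho> u)))
      = (\<integral>\<^sup>+u. ennreal (?\<rho> u) * ennreal (\<bar>f (x + u) - f x\<bar>\<^sup>2) \<partial>lborel)"
    by (rule nn_integral_density) measurable
  also have "\<dots> = (\<integral>\<^sup>+u. ennreal ((norm (complex_of_real (f (x + u)) - of_real (f x)))\<^sup>2 * ?\<rho> u) \<partial>lborel)"
  proof (intro nn_integral_cong)
    fix u
    have "norm (complex_of_real (f (x + u)) - of_real (f x)) = \<bar>f (x + u) - f x\<bar>"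
      by (simp flip: of_real_diff)
    then show "ennreal (?\<rho> u) * ennreal (\<bar>f (x + u) - f x\<bar>\<^sup>2)
        = ennreal ((norm (complex_of_real (f (x + u)) - of_real (f x)))\<^sup>2 * ?\<rho> u)"
      by (simp only: mult.commute[of "ennreal (?\<rho> u)"] ennreal_mult'[OF zero_le_power2])
  qed
  finally show "(\<integral>\<^sup>+u. ennreal (\<bar>f (x + u) - f x\<bar>\<^sup>2) \<partial>density lborel (\<lambda>u. ennreal (?\<rho> u)))
      = (\<integral>\<^sup>+u. ennreal ((norm (complex_of_real (f (x + u)) - of_real (f x)))\<^sup>2 * ?\<rho> u) \<partial>lborel)" .
qed

lemma ennreal_le_of_divide_le:
  assumes "ennreal v / E \<le> U" "0 < E" "E < \<infinity>"
  shows "ennreal v \<le> U * E"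
proof -
  have "ennreal v = ennreal v / E * E"
    using assms(2,3) by (simp add: ennreal_divide_times ennreal_divide_self less_top[symmetric])
  also have "\<dots> \<le> U * E"
    by (intro mult_right_mono assms) simp
  finally show ?thesis .
qed

theorem corollary5p1:
  fixes \<alpha> :: real
    and M :: "'b measure"
    and X :: "'b \<Rightarrow> 'a::euclidean_space"
  assumes "1 < \<alpha>" and "\<alpha> < 2"
    and "prob_space M"
    and "X \<in> borel_measurable M"
    and "rotationally_invariant (distr M borel X)"
    and "stable_law \<alpha> (distr M borel X)"
    and "\<And>\<xi>. char_fun (distr M borel X) \<xi> = complex_of_real (exp (- (norm \<xi> powr \<alpha>) / 2))"
  shows "U_stable \<alpha> (distr M borel X) = 1"
proof -
  note \<alpha> = assms(1,2)
  define \<mu> where "\<mu> = distr M borel X"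
  have \<mu>: "prob_space \<mu>" "sets \<mu> = sets borel"
    "\<And>\<xi>. char_fun \<mu> \<xi> = complex_of_real (exp (- (norm \<xi> powr \<alpha>) / 2))"
    unfolding \<mu>_def by (simp_all add: assms prob_space.prob_space_distr)
  define \<rho> where "\<rho> u = stable_const \<alpha> DIM('a) / norm u powr (real DIM('a) + \<alpha>)" for u :: 'a
  have exponent: "levy_exp \<rho> \<xi> = norm \<xi> powr \<alpha> / 2" for \<xi>
    unfolding \<rho>_def[abs_def] by (rule symmetric_jump_law_stable(2)[OF \<alpha> \<mu>])
  interpret symmetric_jump_law \<mu> \<rho>
    unfolding \<rho>_def[abs_def] by (rule symmetric_jump_law_stable(1)[OF \<alpha> \<mu>])
  let ?U = "U_stable \<alpha> \<mu>"
  have energy: "stable_energy \<alpha> \<mu> f = jump_energy \<mu> \<rho> (\<lambda>x. of_real (f x))"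
    if "f \<in> borel_measurable borel" for f
    unfolding \<rho>_def[abs_def] by (rule stable_energy_eq_jump_energy[OF \<alpha> that])
  have "?U \<le> 1"
    unfolding U_stable_def
  proof (rule SUP_least)
    fix f
    assume "f \<in> H_stable \<alpha> \<mu>"
    then have f: "f \<in> borel_measurable borel" "finite_variance \<mu> f"
      and E: "0 < stable_energy \<alpha> \<mu> f" "stable_energy \<alpha> \<mu> f < \<infinity>"
      by (auto simp: H_stable_def)
    have "ennreal (variance f) / stable_energy \<alpha> \<mu> f \<le> stable_energy \<alpha> \<mu> f / stable_energy \<alpha> \<mu> f"
      using poincare[OF f] by (intro divide_right_mono_ennreal) (simp add: energy f)
    also have "\<dots> = 1"
      using E by (intro ennreal_divide_self) auto
    finally show "ennreal (variance f) / stable_energy \<alpha> \<mu> f \<le> 1" .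
  qed
  \<comment> \<open>A function of zero energy lies outside \<open>H_stable\<close>, but then the
    Poincare inequality makes its variance vanish. The bound thus holds for cosine and sine alike,
    whichever of their energies is positive.\<close>
  have var_le: "ennreal (variance f) \<le> ?U * stable_energy \<alpha> \<mu> f"
    if f [measurable]: "f \<in> borel_measurable borel" and bound: "\<And>x. \<bar>f x\<bar> \<le> 1"
      and E: "stable_energy \<alpha> \<mu> f < \<infinity>" for f
  proof -
    have int: "integrable \<mu> f" "integrable \<mu> (\<lambda>x. (f x)\<^sup>2)"
      using bound by (auto intro!: integrable_const_bound[of _ 1] simp: abs_square_le_1)
    then have fin: "finite_variance \<mu> f"
      by (simp add: finite_variance_def power2_diff)
    show ?thesis
    proof (cases "stable_energy \<alpha> \<mu> f = 0")
      case True
      then show ?thesis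
        using poincare[OF f fin] by (simp add: energy f)
    next
      case False
      with f fin E have "f \<in> H_stable \<alpha> \<mu>"
        by (simp add: H_stable_def zero_less_iff_neq_zero)
      then have "ennreal (variance f) / stable_energy \<alpha> \<mu> f \<le> ?U"
        unfolding U_stable_def by (rule SUP_upper)
      then show ?thesis
        using False E by (intro ennreal_le_of_divide_le) (auto simp: zero_less_iff_neq_zero)
    qed
  qed
  obtain u where u: "?U = ennreal u" "0 \<le> u"
    using \<open>?U \<le> 1\<close> by (cases ?U) (auto simp: top_unique)
  \<comment> \<open>The supremum is a common factor, so the bounds for cosine and sine can be added;
    their variances total \<open>1 - exp (- t)\<close> and their energies \<open>t\<close>.\<close>
  have ratio: "(1 - exp (- t)) / t \<le> u" if t: "0 < t" for t
  proof -
    obtain b :: 'a where b: "b \<in> Basis" using nonempty_Basis by blast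
    \<comment> \<open>The length is chosen so that
      \<open>norm \<xi> powr \<alpha> = t\<close>.\<close>
    define \<xi> where "\<xi> = (t powr (1 / \<alpha>)) *\<^sub>R b"
    have \<psi>: "2 * levy_exp \<rho> \<xi> = t"
      using b \<alpha> t by (simp add: exponent \<xi>_def powr_powr)
    let ?c = "\<lambda>x. cos (\<xi> \<bullet> x)" and ?s = "\<lambda>x. sin (\<xi> \<bullet> x)"
    have [measurable]: "?c \<in> borel_measurable borel" "?s \<in> borel_measurable borel"
      by measurable
    have sum: "stable_energy \<alpha> \<mu> ?c + stable_energy \<alpha> \<mu> ?s = ennreal t"
      using iexp_energy[of \<xi>] by (simp add: energy \<psi>)
    then have fin: "stable_energy \<alpha> \<mu> ?c < \<infinity>" "stable_energy \<alpha> \<mu> ?s < \<infinity>"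
      by (metis ennreal_add_eq_top ennreal_less_top infinity_ennreal_def less_top)+
    have "ennreal (1 - exp (- t)) = ennreal (variance ?c) + ennreal (variance ?s)"
      using iexp_variance[of \<xi>] by (simp add: \<psi> flip: ennreal_plus)
    also have "\<dots> \<le> ?U * stable_energy \<alpha> \<mu> ?c + ?U * stable_energy \<alpha> \<mu> ?s"
      by (intro add_mono var_le fin) auto
    also have "\<dots> = ennreal (u * t)"
      unfolding distrib_left[symmetric] sum u using u t by (simp add: ennreal_mult)
    finally have "1 - exp (- t) \<le> u * t"
      using u t by (subst (asm) ennreal_le_iff) auto
    then show ?thesis
      using t by (simp add: divide_le_eq)
  qed
  have "1 \<le> u"
  proof (rule tendsto_upperbound)
    \<comment> \<open>The ratio is the difference quotient of \<open>1 - exp (- t)\<close> at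
      \<open>0\<close>, so small frequencies push the lower bound up to the slope
      \<open>1\<close>.\<close>
    have "((\<lambda>t. 1 - exp (- t)) has_real_derivative 1) (at 0)"
      by (auto intro!: derivative_eq_intros)
    then have "((\<lambda>t. (1 - exp (- t)) / t) \<longlongrightarrow> (1::real)) (at 0)"
      by (simp add: DERIV_def)
    then show "((\<lambda>t. (1 - exp (- t)) / t) \<longlongrightarrow> (1::real)) (at_right 0)"
      by (rule filterlim_at_split[THEN iffD1, THEN conjunct2])
    show "\<forall>\<^sub>F t in at_right 0. (1 - exp (- t)) / t \<le> u"
      using eventually_at_right_less by (rule eventually_mono) (rule ratio)
  qed simp
  with u \<open>?U \<le> 1\<close> show ?thesis
    unfolding \<mu>_def[symmetric] by (simp add: antisym)
qed

end
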